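(* Let $M^{2n+1}(\varphi,Q,\xi,\eta,g)$ be a weak nearly cosymplectic manifold satisfying (A) $(\nabla_X Q)Y=0$ for all $X\in\mathfrak{X}_M$, $Y\in\ker\eta$, and (B) $R_{\widetilde Q X,Y}Z\in\ker\eta$ for all $X,Y,Z\in\ker\eta$. Let $h=\nabla\xi$, i.e. $hX=\nabla_X\xi$, and suppose that $0$ is a simple eigenvalue of $h^2$. Then $M$ is a 5-dimensional manifold.
   Context: $\mathfrak{X}_M$ denotes the vector fields on $M$. A weak almost contact structure on a smooth manifold $M^{2n+1}$ ($n\ge1$) is a set $(\varphi,Q,\xi,\eta)$, where $\varphi$ is a $(1,1)$-tensor, $\xi$ a vector field, $\eta$ a 1-form and $Q$ a nonsingular $(1,1)$-tensor on $TM$, satisfying $\varphi^2=-Q+\eta\otimes\xi$, $\eta(\xi)=1$, $Q\xi=\xi$; the distribution $\ker\eta$ is assumed $\varphi$-invariant. Put $\widetilde Q=Q-\mathrm{id}$. If $g$ is a Riemannian metric with $g(\varphi X,\varphi Y)=g(X,QY)-\eta(X)\eta(Y)$ for all $X,Y\in\mathfrak{X}_M$, then $(\varphi,Q,\xi,\eta,g)$ is a weak almost contact metric structure. Let $\nabla$ be the Levi-Civita connection of $g$ and $R_{X,Y}Z=\nabla_X\nabla_YZ-\nabla_Y\nabla_XZ-\nabla_{[X,Y]}Z$. The structure is weak nearly cosymplectic if $(\nabla_Y\varphi)Z+(\nabla_Z\varphi)Y=0$ for all $Y,Z\in\mathfrak{X}_M$. Under condition (A), the vector field $\xi$ is Killing,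 $h$ is skew-symmetric, and hence $h^2$ is self-adjoint with $h\xi=0$. *)

theory Defs
  imports "HOL-Analysis.Analysis" "HOL-Library.Function_Algebras"
begin

text \<open>
  A manifold is a whole topological type \<open>'a\<close> together with a smooth atlas modelled on a Euclidean
  space \<open>'e\<close>; its dimension is \<open>DIM('e)\<close>. Tangent vectors are derivations of the algebra of smooth
  functions; scalar multiplication on functions is the pointwise one.
\<close>

instantiation "fun" :: (type, real_vector) real_vector
begin

definition scaleR_fun :: "real \<Rightarrow> ('a \<Rightarrow> 'b) \<Rightarrow> 'a \<Rightarrow> 'b" where
  "scaleR_fun c f = (\<lambda>x. c *\<^sub>R f x)"

instance
  by standard (simp_all add: scaleR_fun_def fun_eq_iff scaleR_add_right scaleR_add_left)

end


section \<open>Smooth manifolds\<close>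

text \<open>For finite-dimensional domains, continuity of all iterated directional derivatives of a
  differentiable map up to order \<open>k\<close> is the same as being of class \<open>C\<^sup>k\<close>.\<close>

primrec Ck_on ::
  "nat \<Rightarrow> 'e::euclidean_space set \<Rightarrow> ('e \<Rightarrow> 'b::real_normed_vector) \<Rightarrow> bool" where
  "Ck_on 0 S f \<longleftrightarrow> continuous_on S f"
| "Ck_on (Suc k) S f \<longleftrightarrow>
     (\<forall>x\<in>S. f differentiable (at x)) \<and>
     (\<forall>v. Ck_on k S (\<lambda>x. frechet_derivative f (at x) v))"

definition smooth_on :: "'e::euclidean_space set \<Rightarrow> ('e \<Rightarrow> 'b::real_normed_vector) \<Rightarrow> bool" where
  "smooth_on S f \<longleftrightarrow> (\<forall>k. Ck_on k S f)"

type_synonym ('a, 'e) chart = "'a set \<times> ('a \<Rightarrow> 'e)"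

definition is_chart :: "('a::topological_space, 'e::euclidean_space) chart \<Rightarrow> bool" where
  "is_chart c \<longleftrightarrow> (case c of (U, \<psi>) \<Rightarrow>
     open U \<and> open (\<psi> ` U) \<and> homeomorphism U (\<psi> ` U) \<psi> (inv_into U \<psi>))"

definition smooth_atlas :: "('a::topological_space, 'e::euclidean_space) chart set \<Rightarrow> bool" where
  "smooth_atlas \<A> \<longleftrightarrow>
     (\<forall>c\<in>\<A>. is_chart c) \<and>
     (\<Union>(U, \<psi>)\<in>\<A>. U) = UNIV \<and>
     (\<forall>(U, \<psi>)\<in>\<A>. \<forall>(V, \<theta>)\<in>\<A>. smooth_on (\<psi> ` (U \<inter> V)) (\<theta> \<circ> inv_into U \<psi>))"

definition smooth_functions ::
  "('a::topological_space, 'e::euclidean_space) chart set \<Rightarrow> ('a \<Rightarrow> real) set" where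
  "smooth_functions \<A> = {f. \<forall>(U, \<psi>)\<in>\<A>. smooth_on (\<psi> ` U) (f \<circ> inv_into U \<psi>)}"


section \<open>Tangent vectors, vector fields and tensor fields\<close>

type_synonym 'a tvec = "('a \<Rightarrow> real) \<Rightarrow> real"
type_synonym 'a vfield = "'a \<Rightarrow> 'a tvec"
type_synonym 'a one_form = "'a \<Rightarrow> 'a tvec \<Rightarrow> real"
type_synonym 'a tensor11 = "'a \<Rightarrow> 'a tvec \<Rightarrow> 'a tvec"
type_synonym 'a tensor02 = "'a \<Rightarrow> 'a tvec \<Rightarrow> 'a tvec \<Rightarrow> real"
type_synonym 'a conn = "'a vfield \<Rightarrow> 'a vfield \<Rightarrow> 'a vfield"

text \<open>The last clause only fixes the irrelevant values at non-smooth functions, so that equality of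
  derivations is equality of HOL functions.\<close>

definition tangent_space ::
  "('a::topological_space, 'e::euclidean_space) chart set \<Rightarrow> 'a \<Rightarrow> 'a tvec set" where
  "tangent_space \<A> p = {v.
     (\<forall>f\<in>smooth_functions \<A>. \<forall>g\<in>smooth_functions \<A>. v (f + g) = v f + v g) \<and>
     (\<forall>f\<in>smooth_functions \<A>. \<forall>c. v (c *\<^sub>R f) = c * v f) \<and>
     (\<forall>f\<in>smooth_functions \<A>. \<forall>g\<in>smooth_functions \<A>. v (f * g) = f p * v g + g p * v f) \<and>
     (\<forall>f. f \<notin> smooth_functions \<A> \<longrightarrow> v f = 0)}"

definition vector_fields ::
  "('a::topological_space, 'e::euclidean_space) chart set \<Rightarrow> 'a vfield set" where
  "vector_fields \<A> = {X.
     (\<forall>p. X p \<in> tangent_space \<A> p) \<and>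
     (\<forall>f\<in>smooth_functions \<A>. (\<lambda>p. X p f) \<in> smooth_functions \<A>)}"

definition fmult :: "('a \<Rightarrow> real) \<Rightarrow> 'a vfield \<Rightarrow> 'a vfield" where
  "fmult f X = (\<lambda>p. f p *\<^sub>R X p)"

definition vderiv :: "'a vfield \<Rightarrow> ('a \<Rightarrow> real) \<Rightarrow> 'a \<Rightarrow> real" where
  "vderiv X f = (\<lambda>p. X p f)"

definition lie_bracket :: "'a vfield \<Rightarrow> 'a vfield \<Rightarrow> 'a vfield" where
  "lie_bracket X Y = (\<lambda>p f. X p (vderiv Y f) - Y p (vderiv X f))"

definition tapply :: "('a \<Rightarrow> 'a tvec \<Rightarrow> 'b) \<Rightarrow> 'a vfield \<Rightarrow> 'a \<Rightarrow> 'b" where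
  "tapply T X = (\<lambda>p. T p (X p))"

definition tapply2 :: "'a tensor02 \<Rightarrow> 'a vfield \<Rightarrow> 'a vfield \<Rightarrow> 'a \<Rightarrow> real" where
  "tapply2 g X Y = (\<lambda>p. g p (X p) (Y p))"

definition linear_on_space :: "'v::real_vector set \<Rightarrow> ('v \<Rightarrow> 'w::real_vector) \<Rightarrow> bool" where
  "linear_on_space V L \<longleftrightarrow>
     (\<forall>u\<in>V. \<forall>v\<in>V. L (u + v) = L u + L v) \<and> (\<forall>u\<in>V. \<forall>c. L (c *\<^sub>R u) = c *\<^sub>R L u)"

text \<open>Tensor fields are families of (multi)linear maps on the tangent spaces; smoothness means that
  they send smooth vector fields to smooth objects. Their values outside the tangent spaces are
  irrelevant.\<close>

definition is_one_form ::
  "('a::topological_space, 'e::euclidean_space) chart set \<Rightarrow> 'a one_form \<Rightarrow> bool" where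
  "is_one_form \<A> \<eta> \<longleftrightarrow>
     (\<forall>p. linear_on_space (tangent_space \<A> p) (\<eta> p)) \<and>
     (\<forall>X\<in>vector_fields \<A>. tapply \<eta> X \<in> smooth_functions \<A>)"

definition is_tensor11 ::
  "('a::topological_space, 'e::euclidean_space) chart set \<Rightarrow> 'a tensor11 \<Rightarrow> bool" where
  "is_tensor11 \<A> T \<longleftrightarrow>
     (\<forall>p. T p ` tangent_space \<A> p \<subseteq> tangent_space \<A> p \<and>
          linear_on_space (tangent_space \<A> p) (T p)) \<and>
     (\<forall>X\<in>vector_fields \<A>. tapply T X \<in> vector_fields \<A>)"

definition nonsingular ::
  "('a::topological_space, 'e::euclidean_space) chart set \<Rightarrow> 'a tensor11 \<Rightarrow> bool" where
  "nonsingular \<A> T \<longleftrightarrow> (\<forall>p. bij_betw (T p) (tangent_space \<A> p) (tangent_space \<A> p))"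

definition riemannian_metric ::
  "('a::topological_space, 'e::euclidean_space) chart set \<Rightarrow> 'a tensor02 \<Rightarrow> bool" where
  "riemannian_metric \<A> g \<longleftrightarrow>
     (\<forall>p. \<forall>u\<in>tangent_space \<A> p.
        linear_on_space (tangent_space \<A> p) (g p u) \<and>
        (\<forall>v\<in>tangent_space \<A> p. g p u v = g p v u) \<and>
        (u \<noteq> 0 \<longrightarrow> g p u u > 0)) \<and>
     (\<forall>X\<in>vector_fields \<A>. \<forall>Y\<in>vector_fields \<A>. tapply2 g X Y \<in> smooth_functions \<A>)"


section \<open>Connections and curvature\<close>

definition affine_connection ::
  "('a::topological_space, 'e::euclidean_space) chart set \<Rightarrow> 'a conn \<Rightarrow> bool" where
  "affine_connection \<A> D \<longleftrightarrow>
     (\<forall>X\<in>vector_fields \<A>. \<forall>Y\<in>vector_fields \<A>.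
        D X Y \<in> vector_fields \<A> \<and>
        (\<forall>Z\<in>vector_fields \<A>. D (X + Y) Z = D X Z + D Y Z \<and> D X (Y + Z) = D X Y + D X Z) \<and>
        (\<forall>f\<in>smooth_functions \<A>.
           D (fmult f X) Y = fmult f (D X Y) \<and>
           D X (fmult f Y) = fmult (vderiv X f) Y + fmult f (D X Y)))"

definition levi_civita ::
  "('a::topological_space, 'e::euclidean_space) chart set \<Rightarrow> 'a tensor02 \<Rightarrow> 'a conn \<Rightarrow> bool" where
  "levi_civita \<A> g D \<longleftrightarrow>
     affine_connection \<A> D \<and>
     (\<forall>X\<in>vector_fields \<A>. \<forall>Y\<in>vector_fields \<A>. D X Y - D Y X = lie_bracket X Y) \<and>
     (\<forall>X\<in>vector_fields \<A>. \<forall>Y\<in>vector_fields \<A>. \<forall>Z\<in>vector_fields \<A>.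
        vderiv X (tapply2 g Y Z) = tapply2 g (D X Y) Z + tapply2 g Y (D X Z))"

text \<open>\<open>cov_deriv D X T Y\<close> is \<open>(D\<^sub>X T) Y\<close>.\<close>

definition cov_deriv :: "'a conn \<Rightarrow> 'a vfield \<Rightarrow> 'a tensor11 \<Rightarrow> 'a vfield \<Rightarrow> 'a vfield" where
  "cov_deriv D X T Y = D X (tapply T Y) - tapply T (D X Y)"

definition curvature :: "'a conn \<Rightarrow> 'a vfield \<Rightarrow> 'a vfield \<Rightarrow> 'a vfield \<Rightarrow> 'a vfield" where
  "curvature D X Y Z = D X (D Y Z) - D Y (D X Z) - D (lie_bracket X Y) Z"


section \<open>Weak almost contact metric structures\<close>

definition weak_almost_contact ::
  "('a::topological_space, 'e::euclidean_space) chart set \<Rightarrow>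
   'a tensor11 \<Rightarrow> 'a tensor11 \<Rightarrow> 'a vfield \<Rightarrow> 'a one_form \<Rightarrow> bool" where
  "weak_almost_contact \<A> \<phi> Q \<xi> \<eta> \<longleftrightarrow>
     is_tensor11 \<A> \<phi> \<and> is_tensor11 \<A> Q \<and> nonsingular \<A> Q \<and>
     \<xi> \<in> vector_fields \<A> \<and> is_one_form \<A> \<eta> \<and>
     (\<forall>p. \<forall>v\<in>tangent_space \<A> p. \<phi> p (\<phi> p v) = - Q p v + \<eta> p v *\<^sub>R \<xi> p) \<and>
     (\<forall>p. \<eta> p (\<xi> p) = 1) \<and>
     (\<forall>p. Q p (\<xi> p) = \<xi> p) \<and>
     (\<forall>p. \<forall>v\<in>tangent_space \<A> p. \<eta> p v = 0 \<longrightarrow> \<eta> p (\<phi> p v) = 0)"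

definition weak_almost_contact_metric ::
  "('a::topological_space, 'e::euclidean_space) chart set \<Rightarrow>
   'a tensor11 \<Rightarrow> 'a tensor11 \<Rightarrow> 'a vfield \<Rightarrow> 'a one_form \<Rightarrow> 'a tensor02 \<Rightarrow> bool" where
  "weak_almost_contact_metric \<A> \<phi> Q \<xi> \<eta> g \<longleftrightarrow>
     weak_almost_contact \<A> \<phi> Q \<xi> \<eta> \<and> riemannian_metric \<A> g \<and>
     (\<forall>X\<in>vector_fields \<A>. \<forall>Y\<in>vector_fields \<A>.
        tapply2 g (tapply \<phi> X) (tapply \<phi> Y) = tapply2 g X (tapply Q Y) - tapply \<eta> X * tapply \<eta> Y)"

text \<open>Here \<open>D\<close> is the Levi-Civita connection of \<open>g\<close>, which is unique on vector fields.\<close>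

definition weak_nearly_cosymplectic ::
  "('a::topological_space, 'e::euclidean_space) chart set \<Rightarrow>
   'a tensor11 \<Rightarrow> 'a tensor11 \<Rightarrow> 'a vfield \<Rightarrow> 'a one_form \<Rightarrow> 'a tensor02 \<Rightarrow> 'a conn \<Rightarrow> bool" where
  "weak_nearly_cosymplectic \<A> \<phi> Q \<xi> \<eta> g D \<longleftrightarrow>
     weak_almost_contact_metric \<A> \<phi> Q \<xi> \<eta> g \<and> levi_civita \<A> g D \<and>
     (\<forall>Y\<in>vector_fields \<A>. \<forall>Z\<in>vector_fields \<A>. cov_deriv D Y \<phi> Z + cov_deriv D Z \<phi> Y = 0)"

definition ker_fields ::
  "('a::topological_space, 'e::euclidean_space) chart set \<Rightarrow> 'a one_form \<Rightarrow> 'a vfield set" where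
  "ker_fields \<A> \<eta> = {X \<in> vector_fields \<A>. tapply \<eta> X = 0}"

definition tilde :: "'a tensor11 \<Rightarrow> 'a tensor11" where
  "tilde Q = (\<lambda>p v. Q p v - v)"

text \<open>Simplicity is one-dimensionality of the eigenspace. For self-adjoint operators this is the same
  as algebraic multiplicity one; in general, it is the weaker of the two requirements.\<close>

definition simple_eigenvalue_on :: "'v::real_vector set \<Rightarrow> ('v \<Rightarrow> 'v) \<Rightarrow> real \<Rightarrow> bool" where
  "simple_eigenvalue_on V L c \<longleftrightarrow> dim {v \<in> V. L v = c *\<^sub>R v} = 1"

end

theory Submission
  imports Defs
begin

text \<open>
  Condition (A) forces \<open>Q\<close> to fix every vector in the image of \<open>h\<close>. If \<open>0\<close> is a simple eigenvalue of
  \<open>h\<^sup>2\<close>, that image is \<open>ker \<eta>\<close>, so \<open>Q = id\<close> and the structure is nearly cosymplectic in the classical sense.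
  Then \<open>T(X, Y, Z) = g((D\<^sub>X \<phi>) Y, Z)\<close> is a closed 3-form, being one third of \<open>d\<Phi>\<close> for
  \<open>\<Phi>(X, Y) = g(\<phi> X, Y)\<close>. Comparing the \<open>\<xi>\<close>-component of \<open>dT = 0\<close> with \<open>\<phi>\<^sup>2 = - id\<close>, \<open>\<phi> h = - h \<phi>\<close> on
  \<open>ker \<eta>\<close> and \<open>d d\<eta> = 0\<close> shows that \<open>T\<close> vanishes on \<open>ker \<eta>\<close>, so \<open>T = \<eta> \<and> \<Psi>\<close> with
  \<open>\<Psi>(X, Y) = g(\<phi> h X, Y)\<close>. The remaining part of \<open>dT = 0\<close> is \<open>d\<eta> \<and> \<Psi> = 0\<close> on \<open>ker \<eta>\<close>, which is only
  possible when \<open>ker \<eta>\<close> is spanned by \<open>x, \<phi> x, h x, \<phi> h x\<close> for any nonzero \<open>x\<close> in it.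
\<close>

section \<open>Smooth functions on Euclidean spaces\<close>

text \<open>Tangent vectors are derivations of globally defined functions, and the hypotheses speak
  of global vector fields, while the final argument is linear algebra at one point. The bridge is
  that a tangent space is a linear copy of the model space and that each tangent vector is the value
  of a smooth field. Both facts rest on bump functions and Hadamard's lemma, which is why the
  development begins with real analysis. For the same reason exterior derivatives are written with
  Lie brackets of global fields, without local frames.

  The eigenvalue assumption acts through surjectivity. As \<open>h \<xi> = 0\<close>, the kernel of
  \<open>h\<^sup>2\<close> is the line of \<xi>, so \<open>h + \<eta> \<otimes> \<xi>\<close> is
  injective and, by finite dimension, onto. This is used twice: to pass from "Q fixes the image of
  h" to Q = id, and to pass from T(X, Y, h Z) = 0 to the vanishing of T on ker \<eta>.

  The obstacle in the second step is that dT = 0 involves derivatives of h. They are eliminated by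
  computing the derivative of T along \<xi> in two ways: from dT = 0, and from the way \<phi> moves
  between the slots of T.\<close>

lemma Ck_on_subset: "Ck_on k S f \<Longrightarrow> T \<subseteq> S \<Longrightarrow> Ck_on k T f"
proof (induction k arbitrary: f)
  case 0 then show ?case using continuous_on_subset by auto
next
  case (Suc k) then show ?case by auto
qed

lemma frechet_derivative_cong_open:
  assumes "open S" "x \<in> S" "\<And>y. y \<in> S \<Longrightarrow> f y = g y"
  shows "frechet_derivative f (at x) = frechet_derivative g (at x)"
proof -
  have "(f has_derivative d) (at x) \<longleftrightarrow> (g has_derivative d) (at x)" for d
    using assms has_derivative_transform_within_open by metis
  then show ?thesis by (simp add: frechet_derivative_def)
qed

lemma differentiable_cong_open:
  assumes "open S" "x \<in> S" "\<And>y. y \<in> S \<Longrightarrow> f y = g y" "f differentiable (at x)"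
  shows "g differentiable (at x)"
  using assms has_derivative_transform_within_open unfolding differentiable_def by metis

text \<open>Lets an explicit derivative formula, valid only on \<open>S\<close>, stand in for
  \<open>frechet_derivative\<close> in the induction steps of the closure lemmas that
  follow.\<close>

lemma Ck_on_cong:
  assumes "open S" "\<And>y. y \<in> S \<Longrightarrow> f y = g y" "Ck_on k S f"
  shows "Ck_on k S g"
  using assms(2,3)
proof (induction k arbitrary: f g)
  case 0 then show ?case by (simp cong: continuous_on_cong)
next
  case (Suc k)
  have "Ck_on k S (\<lambda>x. frechet_derivative g (at x) v)" for v
  proof (rule Suc.IH[of "\<lambda>x. frechet_derivative f (at x) v"])
    show "frechet_derivative f (at y) v = frechet_derivative g (at y) v" if "y \<in> S" for y
      using frechet_derivative_cong_open[OF \<open>open S\<close> that Suc.prems(1)] by simp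
    show "Ck_on k S (\<lambda>x. frechet_derivative f (at x) v)" using Suc.prems(2) by simp
  qed
  moreover have "g differentiable (at x)" if "x \<in> S" for x
    using differentiable_cong_open[OF \<open>open S\<close> that Suc.prems(1)] Suc.prems(2) that by auto
  ultimately show ?case by simp
qed

text \<open>Differentiability and continuity are local; this is what glues a cut-off function to
  zero and one chart to another.\<close>

lemma Ck_on_local:
  assumes "\<And>x. x \<in> S \<Longrightarrow> \<exists>N. open N \<and> x \<in> N \<and> Ck_on k N f"
  shows "Ck_on k S f"
  using assms
proof (induction k arbitrary: f)
  case 0
  have "continuous (at x) f" if "x \<in> S" for x
    using 0[OF that] continuous_on_eq_continuous_at by fastforce
  then show ?case by (simp add: continuous_at_imp_continuous_on)
next
  case (Suc k)
  have "f differentiable (at x)" if "x \<in> S" for x using Suc.prems[OF that] by auto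
  moreover have "Ck_on k S (\<lambda>x. frechet_derivative f (at x) v)" for v
    by (rule Suc.IH) (use Suc.prems in fastforce)
  ultimately show ?case by simp
qed

lemma Ck_on_continuous: "Ck_on k S f \<Longrightarrow> continuous_on S f"
proof (cases k)
  case (Suc m)
  assume "Ck_on k S f"
  then show ?thesis using Suc
    by (auto intro!: differentiable_imp_continuous_on simp: differentiable_on_def differentiable_at_withinI)
qed auto

lemma Ck_on_Suc_imp: "Ck_on (Suc k) S f \<Longrightarrow> Ck_on k S f"
proof (induction k arbitrary: f)
  case 0 then show ?case using Ck_on_continuous by (metis Ck_on.simps(1))
next
  case (Suc k)
  then show ?case by (metis Ck_on.simps(2))
qed

lemma Ck_on_Suc_has_derivative:
  "Ck_on (Suc k) S f \<Longrightarrow> x \<in> S \<Longrightarrow> (f has_derivative frechet_derivative f (at x)) (at x)"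
  using frechet_derivative_works by auto

lemma Ck_on_Suc_frechet_derivative:
  "Ck_on (Suc k) S f \<Longrightarrow> Ck_on k S (\<lambda>x. frechet_derivative f (at x) v)"
  by simp

lemma Ck_on_const [simp]: "Ck_on k S (\<lambda>x. c)"
proof (induction k arbitrary: c)
  case (Suc k) then show ?case by (simp add: frechet_derivative_const)
qed simp

lemma Ck_on_add:
  assumes "open S" "Ck_on k S f" "Ck_on k S g"
  shows "Ck_on k S (\<lambda>x. f x + g x)"
  using assms(2,3)
proof (induction k arbitrary: f g)
  case 0 then show ?case by (simp add: continuous_on_add)
next
  case (Suc k)
  have d: "((\<lambda>x. f x + g x) has_derivative
      (\<lambda>v. frechet_derivative f (at x) v + frechet_derivative g (at x) v)) (at x)" if "x \<in> S" for x
    by (rule has_derivative_add) (use Suc.prems that in \<open>auto intro: frechet_derivative_works[THEN iffD1]\<close>)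
  have "Ck_on k S (\<lambda>x. frechet_derivative (\<lambda>x. f x + g x) (at x) v)" for v
    by (rule Ck_on_cong[OF \<open>open S\<close> _ Suc.IH])
      (use Suc.prems frechet_derivative_at[OF d] in \<open>auto simp: fun_eq_iff\<close>)
  then show ?case using d by (auto simp: differentiable_def)
qed

lemma Ck_on_sum:
  assumes "open S" "\<And>i. i \<in> I \<Longrightarrow> Ck_on k S (f i)"
  shows "Ck_on k S (\<lambda>x. \<Sum>i\<in>I. f i x)"
  using assms(2) by (induction I rule: infinite_finite_induct) (auto intro: Ck_on_add[OF assms(1)])

lemma Ck_on_bounded_linear_comp:
  assumes "open S" "bounded_linear L" "Ck_on k S f"
  shows "Ck_on k S (\<lambda>x. L (f x))"
  using assms(3)
proof (induction k arbitrary: f)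
  case 0
  then show ?case using bounded_linear.continuous_on[OF assms(2)] by simp
next
  case (Suc k)
  have d: "((\<lambda>x. L (f x)) has_derivative (\<lambda>v. L (frechet_derivative f (at x) v))) (at x)" if "x \<in> S" for x
    using bounded_linear.has_derivative[OF assms(2)] Ck_on_Suc_has_derivative Suc.prems that by blast
  have "Ck_on k S (\<lambda>x. frechet_derivative (\<lambda>x. L (f x)) (at x) v)" for v
    by (rule Ck_on_cong[OF \<open>open S\<close> _ Suc.IH])
      (use Suc.prems frechet_derivative_at[OF d] in \<open>auto simp: fun_eq_iff\<close>)
  then show ?case using d by (auto simp: differentiable_def)
qed

lemma Ck_on_mult:
  fixes f g :: "'e::euclidean_space \<Rightarrow> real"
  assumes "open S" "Ck_on k S f" "Ck_on k S g"
  shows "Ck_on k S (\<lambda>x. f x * g x)"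
  using assms(2,3)
proof (induction k arbitrary: f g)
  case 0 then show ?case by (simp add: continuous_on_mult)
next
  case (Suc k)
  have d: "((\<lambda>x. f x * g x) has_derivative
      (\<lambda>v. f x * frechet_derivative g (at x) v + frechet_derivative f (at x) v * g x)) (at x)"
    if "x \<in> S" for x
    by (rule has_derivative_mult) (use Suc.prems that in \<open>auto intro: frechet_derivative_works[THEN iffD1]\<close>)
  have "Ck_on k S (\<lambda>x. frechet_derivative (\<lambda>x. f x * g x) (at x) v)" for v
  proof (rule Ck_on_cong[OF \<open>open S\<close>])
    show "Ck_on k S (\<lambda>x. f x * frechet_derivative g (at x) v + frechet_derivative f (at x) v * g x)"
      by (intro Ck_on_add[OF \<open>open S\<close>] Suc.IH Suc.prems[THEN Ck_on_Suc_frechet_derivative] Suc.prems[THEN Ck_on_Suc_imp])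
  qed (use frechet_derivative_at[OF d] in \<open>auto simp: fun_eq_iff\<close>)
  then show ?case using d by (auto simp: differentiable_def)
qed

text \<open>The chain rule is expanded over \<open>Basis\<close>, so that the derivative becomes a
  sum of products of scalar functions. The induction generalises over \<open>u\<close> alone, since
  the partial derivatives of \<open>u\<close> are again composed with the same
  \<open>f\<close>.\<close>

lemma Ck_on_compose:
  fixes f :: "'d::euclidean_space \<Rightarrow> 'e::euclidean_space" and u :: "'e \<Rightarrow> real"
  assumes "open S" "open T" "f ` S \<subseteq> T" "Ck_on k T u" "Ck_on k S f"
  shows "Ck_on k S (\<lambda>x. u (f x))"
  using assms(4,5)
proof (induction k arbitrary: u)
  case 0 then show ?case using assms(3) by (auto intro: continuous_on_compose2)
next
  case (Suc k)
  let ?d = "\<lambda>x v. \<Sum>b\<in>Basis. frechet_derivative u (at (f x)) b * (frechet_derivative f (at x) v \<bullet> b)"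
  have d: "((\<lambda>x. u (f x)) has_derivative ?d x) (at x)" if "x \<in> S" for x
  proof -
    have u: "(u has_derivative frechet_derivative u (at (f x))) (at (f x))"
      using Ck_on_Suc_has_derivative Suc.prems that assms(3) by blast
    have f: "(f has_derivative frechet_derivative f (at x)) (at x)"
      using Ck_on_Suc_has_derivative Suc.prems that by blast
    interpret U: bounded_linear "frechet_derivative u (at (f x))"
      using u has_derivative_bounded_linear by blast
    have "frechet_derivative u (at (f x)) (frechet_derivative f (at x) v) = ?d x v" for v
      by (subst euclidean_representation[of "frechet_derivative f (at x) v", symmetric])
        (simp add: U.sum U.scaleR mult.commute)
    then show ?thesis using diff_chain_at[OF f u] by (simp add: o_def)
  qed
  have "Ck_on k S (\<lambda>x. frechet_derivative (\<lambda>x. u (f x)) (at x) v)" for v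
  proof (rule Ck_on_cong[OF \<open>open S\<close>])
    show "Ck_on k S (\<lambda>x. ?d x v)"
      by (intro Ck_on_sum Ck_on_mult Suc.IH Ck_on_bounded_linear_comp[OF _ bounded_linear_inner_left] \<open>open S\<close>
          Suc.prems[THEN Ck_on_Suc_frechet_derivative] Suc.prems[THEN Ck_on_Suc_imp])
  qed (use frechet_derivative_at[OF d] in \<open>auto simp: fun_eq_iff\<close>)
  then show ?case using d by (auto simp: differentiable_def)
qed

lemma Ck_on_bounded_linear: "bounded_linear L \<Longrightarrow> Ck_on k S L"
proof (cases k)
  case (Suc m)
  assume "bounded_linear L"
  then show ?thesis using Suc
    by (auto simp: bounded_linear_imp_differentiable frechet_derivative_at[OF bounded_linear_imp_has_derivative, symmetric])
qed (simp add: linear_continuous_on)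

section \<open>Flat functions built from exp(-1/t)\<close>

definition flat_exp :: "nat \<Rightarrow> real \<Rightarrow> real" where
  "flat_exp m t = (if t > 0 then inverse t ^ m * exp (- inverse t) else 0)"

lemma flat_exp_tendsto: "(flat_exp m \<longlongrightarrow> 0) (at 0)"
proof -
  have "((\<lambda>t. inverse t ^ m / exp (inverse t)) \<longlongrightarrow> (0::real)) (at_right 0)"
    using filterlim_compose[OF tendsto_power_div_exp_0 filterlim_inverse_at_top_right] .
  then have "(flat_exp m \<longlongrightarrow> 0) (at_right 0)"
    by (rule Lim_transform_eventually)
      (auto simp: flat_exp_def eventually_at_right_less exp_minus divide_simps intro!: eventually_mono[OF eventually_at_right_less[of 0]])
  moreover have "(flat_exp m \<longlongrightarrow> 0) (at_left 0)"
    by (rule tendsto_eventually)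
      (auto simp: flat_exp_def eventually_at_filter)
  ultimately show ?thesis using filterlim_split_at by blast
qed

text \<open>The power of 1/t is part of the family so that differentiation does not lead out of it;
  smoothness then follows by induction on the order, for all \<open>m\<close> at once.\<close>

lemma flat_exp_deriv:
  "(flat_exp m has_field_derivative (flat_exp (m+2) t - real m * flat_exp (m+1) t)) (at t)"
proof -
  consider "t > 0" | "t < 0" | "t = 0" by linarith
  then show ?thesis
  proof cases
    case 1
    have "((\<lambda>t. inverse t ^ m * exp (- inverse t)) has_field_derivative
       (flat_exp (m+2) t - real m * flat_exp (m+1) t)) (at t)"
      using 1 by (auto intro!: derivative_eq_intros simp: flat_exp_def field_simps power_Suc power2_eq_square)
         (cases m; simp add: field_simps)
    then show ?thesis
      by (rule has_field_derivative_transform_within_open[of _ _ _ "{0<..}"]) (use 1 in \<open>auto simp: flat_exp_def\<close>)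
  next
    case 2
    have "((\<lambda>t. 0) has_field_derivative (flat_exp (m+2) t - real m * flat_exp (m+1) t)) (at t)"
      using 2 by (simp add: flat_exp_def)
    then show ?thesis
      by (rule has_field_derivative_transform_within_open[of _ _ _ "{..<0}"]) (use 2 in \<open>auto simp: flat_exp_def\<close>)
  next
    case 3
    \<comment> \<open>The difference quotient at 0 is the next member of the family, so its limit is
      already known. At \<open>y = 0\<close> both sides are 0 because division by zero yields
      0.\<close>
    have "flat_exp (Suc m) = (\<lambda>y. (flat_exp m y - flat_exp m 0) / (y - 0))"
      by (auto simp: flat_exp_def divide_inverse)
    then have "((\<lambda>y. (flat_exp m y - flat_exp m 0) / (y - 0)) \<longlongrightarrow> 0) (at 0)"
      using flat_exp_tendsto[of "Suc m"] by metis
    moreover have "flat_exp (m+2) t - real m * flat_exp (m+1) t = 0" using 3 by (simp add: flat_exp_def)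
    ultimately show ?thesis using 3 by (simp only: has_field_derivative_iff)
  qed
qed

lemma Ck_on_flat_exp: "Ck_on k UNIV (flat_exp m)"
proof (induction k arbitrary: m)
  case 0 then show ?case
    using flat_exp_deriv by (auto intro!: continuous_at_imp_continuous_on DERIV_isCont)
next
  case (Suc k)
  have d: "(flat_exp m has_derivative (\<lambda>v. (flat_exp (m+2) t - real m * flat_exp (m+1) t) * v)) (at t)" for t
    using flat_exp_deriv by (simp add: has_field_derivative_def)
  have "Ck_on k UNIV (\<lambda>x. (flat_exp (m+2) x + (- real m) * flat_exp (m+1) x) * v)" for v
    by (intro Ck_on_mult Ck_on_add Suc.IH Ck_on_const open_UNIV)
  then show ?case using d
    by (auto simp: differentiable_def frechet_derivative_at[OF d, symmetric])
qed

section \<open>Hadamard's lemma\<close>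

lemma segment_in_ball:
  fixes a x :: "'e::real_normed_vector"
  assumes "dist a x < R" "0 \<le> t" "t \<le> 1"
  shows "dist a (a + t *\<^sub>R (x - a)) < R"
proof -
  have "norm (t *\<^sub>R (x - a)) \<le> norm (x - a)"
    using assms(2,3) by (simp add: mult_left_le_one_le)
  then show ?thesis using assms(1) by (simp add: dist_norm norm_minus_commute)
qed

text \<open>Differentiating under the integral sign produces an inner factor \<open>t\<close>. The
  weight \<open>t ^ m\<close> absorbs it, so the derivative is an integral of the same kind, with
  \<open>Suc m\<close> and a directional derivative of \<open>f\<close>.\<close>

lemma Ck_on_ray_integral:
  fixes f :: "'e::euclidean_space \<Rightarrow> real"
  assumes "smooth_on (ball a R) f"
  shows "Ck_on k (ball a R) (\<lambda>x. integral (cbox 0 1) (\<lambda>t. t ^ m * f (a + t *\<^sub>R (x - a))))"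
  using assms
proof (induction k arbitrary: f m)
  case 0
  have "continuous_on (ball a R) f" using 0 by (auto simp: smooth_on_def intro: Ck_on_continuous)
  then have "continuous_on (ball a R \<times> cbox 0 1) (\<lambda>(x, t). t ^ m * f (a + t *\<^sub>R (x - a)))"
    using segment_in_ball by (auto simp: split_def intro!: continuous_intros elim!: continuous_on_compose2)
  then show ?case by (simp only: Ck_on.simps) (rule integral_continuous_on_param)
next
  case (Suc k)
  let ?B = "ball a R"
  let ?d = "\<lambda>b x. frechet_derivative f (at x) b"
  \<comment> \<open>The derivative of the integrand as a bounded linear map, as
    \<open>leibniz_rule\<close> wants it; the expansion over \<open>Basis\<close> exhibits its joint
    continuity.\<close>
  define fx where "fx = (\<lambda>x t. \<Sum>b\<in>Basis. (t ^ Suc m * ?d b (a + t *\<^sub>R (x - a))) *\<^sub>R blinfun_inner_left (b::'e))"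
  have Cf: "Ck_on j ?B f" for j using Suc.prems by (auto simp: smooth_on_def)
  have sd: "smooth_on ?B (?d b)" for b
    using Ck_on_Suc_frechet_derivative[OF Cf] by (auto simp: smooth_on_def)
  have cont: "continuous_on ?B f" "continuous_on ?B (?d b)" for b
    using Cf[of 0] sd[of b] by (auto simp: smooth_on_def intro: Ck_on_continuous)
  have der: "((\<lambda>x. t ^ m * f (a + t *\<^sub>R (x - a))) has_derivative blinfun_apply (fx x t)) (at x within ?B)"
    if "x \<in> ?B" "t \<in> cbox 0 1" for x t
  proof -
    let ?y = "a + t *\<^sub>R (x - a)"
    have fd: "(f has_derivative frechet_derivative f (at ?y)) (at ?y)"
      using segment_in_ball that by (intro Ck_on_Suc_has_derivative[OF Cf]) auto
    interpret F: bounded_linear "frechet_derivative f (at ?y)"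
      using fd has_derivative_bounded_linear by blast
    have "((\<lambda>x. a + t *\<^sub>R (x - a)) has_derivative (\<lambda>v. t *\<^sub>R v)) (at x)"
      by (auto intro!: derivative_eq_intros)
    from has_derivative_mult_right[OF diff_chain_at[OF this fd, unfolded o_def], of "t ^ m"]
    have "((\<lambda>x. t ^ m * f (a + t *\<^sub>R (x - a))) has_derivative
        (\<lambda>v. t ^ m * frechet_derivative f (at ?y) (t *\<^sub>R v))) (at x)" .
    moreover have "t ^ m * frechet_derivative f (at ?y) (t *\<^sub>R v) = blinfun_apply (fx x t) v" for v
    proof -
      have "frechet_derivative f (at ?y) v = (\<Sum>b\<in>Basis. (v \<bullet> b) * ?d b ?y)"
        by (subst euclidean_representation[of v, symmetric]) (simp add: F.sum F.scaleR)
      then show ?thesis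
        by (simp add: F.scaleR) (simp add: fx_def blinfun.sum_left blinfun.scaleR_left sum_distrib_left
            inner_commute mult_ac)
    qed
    ultimately show ?thesis by (simp add: has_derivative_at_withinI)
  qed
  have int: "(\<lambda>t. t ^ m * f (a + t *\<^sub>R (x - a))) integrable_on cbox 0 1" if "x \<in> ?B" for x
    using that segment_in_ball
    by (auto intro!: integrable_continuous_interval continuous_intros continuous_on_compose2[OF cont(1)])
  have cfx: "continuous_on (?B \<times> cbox 0 1) (\<lambda>(x, t). fx x t)"
    using segment_in_ball unfolding fx_def split_def
    by (auto intro!: continuous_intros continuous_on_compose2[OF cont(2)])
  have d: "((\<lambda>x. integral (cbox 0 1) (\<lambda>t. t ^ m * f (a + t *\<^sub>R (x - a)))) has_derivative
      blinfun_apply (integral (cbox 0 1) (fx x))) (at x)" if "x \<in> ?B" for x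
    using leibniz_rule[OF der int cfx that] that by (simp add: at_within_open[OF _ open_ball])
  have ev: "blinfun_apply (integral (cbox 0 1) (fx x)) v =
      integral (cbox 0 1) (\<lambda>t. t ^ Suc m * ?d v (a + t *\<^sub>R (x - a)))" if "x \<in> ?B" for x v
  proof -
    have "fx x integrable_on cbox 0 1"
      using that segment_in_ball unfolding fx_def
      by (auto intro!: integrable_continuous_interval continuous_intros continuous_on_compose2[OF cont(2)])
    then have "blinfun_apply (integral (cbox 0 1) (fx x)) v = integral (cbox 0 1) (\<lambda>t. blinfun_apply (fx x t) v)"
      by (rule blinfun_apply_integral)
    also have "\<dots> = integral (cbox 0 1) (\<lambda>t. t ^ Suc m * ?d v (a + t *\<^sub>R (x - a)))"
    proof (rule integral_cong)
      fix t :: real assume t: "t \<in> cbox 0 1"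
      let ?y = "a + t *\<^sub>R (x - a)"
      have fd: "(f has_derivative frechet_derivative f (at ?y)) (at ?y)"
        using segment_in_ball that t by (intro Ck_on_Suc_has_derivative[OF Cf]) auto
      interpret F: bounded_linear "frechet_derivative f (at ?y)"
        using fd has_derivative_bounded_linear by blast
      have "frechet_derivative f (at ?y) v = (\<Sum>b\<in>Basis. (v \<bullet> b) * ?d b ?y)"
        by (subst euclidean_representation[of v, symmetric]) (simp add: F.sum F.scaleR)
      then show "blinfun_apply (fx x t) v = t ^ Suc m * ?d v ?y"
        by (simp add: fx_def blinfun.sum_left blinfun.scaleR_left sum_distrib_left
            inner_commute mult_ac)
    qed
    finally show ?thesis .
  qed
  have "Ck_on k ?B (\<lambda>x. frechet_derivative (\<lambda>x. integral (cbox 0 1) (\<lambda>t. t ^ m * f (a + t *\<^sub>R (x - a)))) (at x) v)" for v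
    by (rule Ck_on_cong[OF open_ball _ Suc.IH[OF sd[of v]]])
      (simp only: frechet_derivative_at[OF d, symmetric] ev)
  then show ?case using differentiableI[OF d] by simp
qed

text \<open>Fundamental theorem of calculus along the segment from \<open>a\<close> to
  \<open>x\<close>: \<open>G b\<close> is the mean over the segment of the partial derivative in
  direction \<open>b\<close>.\<close>

lemma hadamard:
  fixes f :: "'e::euclidean_space \<Rightarrow> real"
  assumes "smooth_on (ball a R) f" "R > 0"
  obtains G where "\<And>b. smooth_on (ball a R) (G b)"
    "\<And>b. G b a = frechet_derivative f (at a) b"
    "\<And>x. x \<in> ball a R \<Longrightarrow> f x = f a + (\<Sum>b\<in>Basis. ((x - a) \<bullet> b) * G b x)"
proof
  let ?d = "\<lambda>b x. frechet_derivative f (at x) b"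
  let ?G = "\<lambda>b x. integral (cbox 0 1) (\<lambda>t. ?d b (a + t *\<^sub>R (x - a)))"
  have Cf: "Ck_on j (ball a R) f" for j using assms by (auto simp: smooth_on_def)
  have sd: "smooth_on (ball a R) (?d b)" for b
    using Ck_on_Suc_frechet_derivative[OF Cf] by (auto simp: smooth_on_def)
  have cont: "continuous_on (ball a R) (?d b)" for b
    using sd[of b] by (auto simp: smooth_on_def intro: Ck_on_continuous)
  show "smooth_on (ball a R) (?G b)" for b
    using Ck_on_ray_integral[OF sd[of b], of _ 0] by (simp add: smooth_on_def)
  show "?G b a = ?d b a" for b by simp
  fix x assume x: "x \<in> ball a R"
  let ?y = "\<lambda>t. a + t *\<^sub>R (x - a)"
  have int: "(\<lambda>t. ?d b (?y t)) integrable_on cbox 0 1" for b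
    using x segment_in_ball by (auto intro!: integrable_continuous_interval continuous_intros continuous_on_compose2[OF cont])
  have "((\<lambda>t. f (?y t)) has_vector_derivative (\<Sum>b\<in>Basis. ((x - a) \<bullet> b) * ?d b (?y t))) (at t within {0..1})"
    if t: "t \<in> {0..1}" for t
  proof -
    have fd: "(f has_derivative frechet_derivative f (at (?y t))) (at (?y t))"
      using segment_in_ball x t by (intro Ck_on_Suc_has_derivative[OF Cf]) auto
    interpret F: bounded_linear "frechet_derivative f (at (?y t))"
      using fd has_derivative_bounded_linear by blast
    have "((\<lambda>t. ?y t) has_derivative (\<lambda>s. s *\<^sub>R (x - a))) (at t)"
      by (auto intro!: derivative_eq_intros)
    from diff_chain_at[OF this fd, unfolded o_def]
    have "((\<lambda>t. f (?y t)) has_derivative (\<lambda>s. s *\<^sub>R frechet_derivative f (at (?y t)) (x - a))) (at t)"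
      by (simp add: F.scaleR)
    moreover have "frechet_derivative f (at (?y t)) (x - a) = (\<Sum>b\<in>Basis. ((x - a) \<bullet> b) * ?d b (?y t))"
      by (subst (2) euclidean_representation[of "x - a", symmetric]) (simp add: F.sum F.scaleR)
    ultimately show ?thesis by (simp add: has_vector_derivative_def has_derivative_at_withinI)
  qed
  then have "((\<lambda>t. \<Sum>b\<in>Basis. ((x - a) \<bullet> b) * ?d b (?y t)) has_integral (f (?y 1) - f (?y 0))) {0..1}"
    by (rule fundamental_theorem_of_calculus[OF zero_le_one])
  then have "f x - f a = integral {0..1} (\<lambda>t. \<Sum>b\<in>Basis. ((x - a) \<bullet> b) * ?d b (?y t))"
    by (simp add: integral_unique)
  also have "\<dots> = (\<Sum>b\<in>Basis. ((x - a) \<bullet> b) * ?G b x)"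
    using int by (subst integral_sum) (auto intro: integrable_on_mult_right)
  finally show "f x = f a + (\<Sum>b\<in>Basis. ((x - a) \<bullet> b) * ?G b x)" by simp
qed

section \<open>Cut-off functions\<close>

lemma smooth_cutoff:
  fixes u \<beta> :: "'e::euclidean_space \<Rightarrow> real"
  assumes "open S" "smooth_on S u" "smooth_on UNIV \<beta>" "cball a r \<subseteq> S" "\<And>y. y \<notin> cball a r \<Longrightarrow> \<beta> y = 0"
  shows "smooth_on UNIV (\<lambda>y. \<beta> y * u y)"
proof -
  have "\<exists>N. open N \<and> x \<in> N \<and> Ck_on k N (\<lambda>y. \<beta> y * u y)" for k x
  proof (cases "x \<in> cball a r")
    case True
    have "Ck_on k S (\<lambda>y. \<beta> y * u y)"
      using assms by (intro Ck_on_mult) (auto simp: smooth_on_def intro: Ck_on_subset)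
    with True show ?thesis using assms by blast
  next
    case False
    have "Ck_on k (- cball a r) (\<lambda>y. \<beta> y * u y)"
      by (rule Ck_on_cong[of _ "\<lambda>_. 0"]) (use assms in auto)
    with False show ?thesis by (intro exI[of _ "- cball a r"]) auto
  qed
  then show ?thesis by (auto simp: smooth_on_def intro!: Ck_on_local)
qed

lemma smooth_bump:
  assumes "r > 0"
  obtains \<beta> :: "'e::euclidean_space \<Rightarrow> real"
  where "smooth_on UNIV \<beta>" "\<beta> a = 1" "\<And>y. y \<notin> cball a r \<Longrightarrow> \<beta> y = 0"
proof
  \<comment> \<open>This is \<open>r\<^sup>2\<close> minus the squared distance to \<open>a\<close>,
    written as a polynomial in coordinates so that the closure lemmas apply. The constant factor in
    the next line normalises the value at \<open>a\<close> to 1.\<close>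
  let ?q = "\<lambda>y. r\<^sup>2 + (-1) * (\<Sum>b\<in>Basis. (((y - a) \<bullet> b) * ((y - a) \<bullet> b)))"
  let ?\<beta> = "\<lambda>y. inverse (flat_exp 0 (r\<^sup>2)) * flat_exp 0 (?q y)"
  have lin: "Ck_on k UNIV (\<lambda>y. (y - a) \<bullet> b)" for k b
    using Ck_on_add[OF open_UNIV Ck_on_bounded_linear[OF bounded_linear_inner_left] Ck_on_const[of _ _ "- (a \<bullet> b)"], of k b]
    by (simp add: inner_diff_left)
  have "Ck_on k UNIV ?\<beta>" for k
    by (intro Ck_on_mult Ck_on_const open_UNIV Ck_on_compose[OF open_UNIV open_UNIV _ Ck_on_flat_exp] subset_UNIV
        Ck_on_add Ck_on_sum lin)
  then show "smooth_on UNIV ?\<beta>" by (simp add: smooth_on_def)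
  show "?\<beta> a = 1" using assms by (simp add: flat_exp_def)
  have q: "?q y = r\<^sup>2 - (norm (y - a))\<^sup>2" for y
    by (simp add: power2_norm_eq_inner euclidean_inner[of "y - a" "y - a"])
  fix y assume "y \<notin> cball a r"
  then have "r < norm (y - a)" by (simp add: dist_norm norm_minus_commute)
  then have "r\<^sup>2 < (norm (y - a))\<^sup>2" using assms by (simp add: power_strict_mono)
  then show "?\<beta> y = 0" unfolding q by (simp add: flat_exp_def)
qed

section \<open>Tangent spaces in coordinates\<close>

lemma smooth_on_frechet_derivative:
  "smooth_on S f \<Longrightarrow> smooth_on S (\<lambda>x. frechet_derivative f (at x) v)"
  unfolding smooth_on_def using Ck_on_Suc_frechet_derivative by blast

lemma smooth_on_inner_diff:
  assumes "open S"
  shows "smooth_on S (\<lambda>y. (y - a) \<bullet> b)"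
  using Ck_on_add[OF assms Ck_on_bounded_linear[OF bounded_linear_inner_left] Ck_on_const[of _ _ "- (a \<bullet> b)"]]
  by (simp add: inner_diff_left smooth_on_def)

lemma sum_apply: "(\<Sum>i\<in>I. f i) x = (\<Sum>i\<in>I. f i x)"
  for f :: "'i \<Rightarrow> 'b \<Rightarrow> 'c::comm_monoid_add"
  by (induction I rule: infinite_finite_induct) auto

lemma smooth_functions_iff:
  "f \<in> smooth_functions \<A> \<longleftrightarrow> (\<forall>(U, \<psi>)\<in>\<A>. smooth_on (\<psi> ` U) (f \<circ> inv_into U \<psi>))"
  by (simp add: smooth_functions_def)

section \<open>Charts and global smooth functions\<close>

context
  fixes \<A> :: "('a::{t2_space, second_countable_topology}, 'e::euclidean_space) chart set"
  assumes atlas: "smooth_atlas \<A>"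
begin

lemma chart_props:
  assumes "(U, \<psi>) \<in> \<A>"
  shows "open U" "open (\<psi> ` U)" "inj_on \<psi> U" "continuous_on U \<psi>"
    "continuous_on (\<psi> ` U) (inv_into U \<psi>)" "homeomorphism U (\<psi> ` U) \<psi> (inv_into U \<psi>)"
proof -
  have *: "open U \<and> open (\<psi> ` U) \<and> homeomorphism U (\<psi> ` U) \<psi> (inv_into U \<psi>)"
  proof -
    have "\<forall>c\<in>\<A>. is_chart c" using atlas unfolding smooth_atlas_def by (rule conjunct1)
    from bspec[OF this assms] show ?thesis by (simp add: is_chart_def)
  qed
  then show "open U" "open (\<psi> ` U)" "homeomorphism U (\<psi> ` U) \<psi> (inv_into U \<psi>)" by auto
  with * show "continuous_on U \<psi>" "continuous_on (\<psi> ` U) (inv_into U \<psi>)"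
    by (auto simp: homeomorphism_def)
  show "inj_on \<psi> U" using * by (auto simp: homeomorphism_def intro: inj_on_inverseI)
qed

lemma chart_at: obtains U \<psi> where "(U, \<psi>) \<in> \<A>" "p \<in> U"
proof -
  have "p \<in> (\<Union>(U, \<psi>)\<in>\<A>. U)" using atlas unfolding smooth_atlas_def by auto
  with that show ?thesis by auto
qed

lemma transition_smooth:
  assumes "(U, \<psi>) \<in> \<A>" "(V, \<theta>) \<in> \<A>"
  shows "smooth_on (\<psi> ` (U \<inter> V)) (\<theta> \<circ> inv_into U \<psi>)"
proof -
  have "\<forall>(U, \<psi>)\<in>\<A>. \<forall>(V, \<theta>)\<in>\<A>. smooth_on (\<psi> ` (U \<inter> V)) (\<theta> \<circ> inv_into U \<psi>)"
    using atlas unfolding smooth_atlas_def by blast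
  from bspec[OF bspec[OF this assms(1), unfolded split_conv] assms(2)] show ?thesis by simp
qed

lemma chart_image_open:
  assumes "(U, \<psi>) \<in> \<A>" "open V"
  shows "open (\<psi> ` (U \<inter> V))"
proof -
  have "openin (top_of_set (\<psi> ` U)) (\<psi> ` (U \<inter> V))"
    using homeomorphism_imp_open_map[OF chart_props(6)[OF assms(1)]] assms(2)
    by (simp add: openin_open_Int)
  then show ?thesis using chart_props(2)[OF assms(1)] openin_open_trans by blast
qed

lemma smooth_functionsI:
  "(\<And>U \<psi> k. (U, \<psi>) \<in> \<A> \<Longrightarrow> Ck_on k (\<psi> ` U) (\<lambda>y. f (inv_into U \<psi> y))) \<Longrightarrow> f \<in> smooth_functions \<A>"
  unfolding smooth_functions_iff smooth_on_def o_def by blast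

lemma smooth_functionsD:
  "f \<in> smooth_functions \<A> \<Longrightarrow> (U, \<psi>) \<in> \<A> \<Longrightarrow> Ck_on k (\<psi> ` U) (\<lambda>y. f (inv_into U \<psi> y))"
  unfolding smooth_functions_iff smooth_on_def o_def by blast

lemma smooth_add: "f \<in> smooth_functions \<A> \<Longrightarrow> g \<in> smooth_functions \<A> \<Longrightarrow> f + g \<in> smooth_functions \<A>"
  by (rule smooth_functionsI, simp only: plus_fun_apply) (intro Ck_on_add chart_props(2) smooth_functionsD)

lemma smooth_mult: "f \<in> smooth_functions \<A> \<Longrightarrow> g \<in> smooth_functions \<A> \<Longrightarrow> f * g \<in> smooth_functions \<A>"
  by (rule smooth_functionsI, simp only: times_fun_apply) (intro Ck_on_mult chart_props(2) smooth_functionsD)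

lemma smooth_const: "(\<lambda>_. c) \<in> smooth_functions \<A>"
  by (rule smooth_functionsI) simp

lemma smooth_scaleR: "f \<in> smooth_functions \<A> \<Longrightarrow> c *\<^sub>R f \<in> smooth_functions \<A>"
  using smooth_mult[OF smooth_const, of f c] by (simp add: scaleR_fun_def times_fun_def)

text \<open>The ball pulled back to the manifold is compact, hence closed because the space is
  Hausdorff. So \<open>U\<close> and the complement of this compact set form an open cover, and in
  any chart the extended function is smooth on each of the two pieces.\<close>

lemma smooth_extend_zero:
  assumes c: "(U, \<psi>) \<in> \<A>" and u: "smooth_on UNIV u" and b: "cball a r \<subseteq> \<psi> ` U"
    and z: "\<And>y. y \<notin> cball a r \<Longrightarrow> u y = 0"
  shows "(\<lambda>q. if q \<in> U then u (\<psi> q) else 0) \<in> smooth_functions \<A>" (is "?u \<in> _")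
proof -
  let ?K = "inv_into U \<psi> ` cball a r"
  have "compact ?K"
    using continuous_on_subset[OF chart_props(5)[OF c] b] compact_cball by (rule compact_continuous_image)
  then have K: "closed ?K" by (rule compact_imp_closed)
  have KU: "?K \<subseteq> U" using b inv_into_into[of _ \<psi> U] by (auto simp: subset_iff)
  have z': "?u q = 0" if "q \<notin> ?K" for q
  proof (cases "q \<in> U")
    case True
    have "q = inv_into U \<psi> (\<psi> q)" using inv_into_f_f[OF chart_props(3)[OF c] True] by simp
    then have "\<psi> q \<notin> cball a r" using that imageI[of "\<psi> q" "cball a r" "inv_into U \<psi>"] by auto
    with True show ?thesis using z by simp
  qed simp
  have "smooth_on (\<theta> ` V) (?u \<circ> inv_into V \<theta>)" if d: "(V, \<theta>) \<in> \<A>" for V \<theta>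
    unfolding smooth_on_def
  proof (intro allI Ck_on_local)
    fix k x assume "x \<in> \<theta> ` V"
    then obtain q where q: "q \<in> V" "x = \<theta> q" by blast
    have inv: "inv_into V \<theta> (\<theta> s) = s" if "s \<in> V" for s
      using inv_into_f_f[OF chart_props(3)[OF d] that] .
    show "\<exists>N. open N \<and> x \<in> N \<and> Ck_on k N (?u \<circ> inv_into V \<theta>)"
    proof (cases "q \<in> U")
      case True
      let ?N = "\<theta> ` (V \<inter> U)"
      have "open ?N" using chart_image_open[OF d chart_props(1)[OF c]] .
      have "Ck_on k ?N (\<psi> \<circ> inv_into V \<theta>)" "Ck_on k UNIV u"
        using transition_smooth[OF d c] u unfolding smooth_on_def by blast+
      from Ck_on_compose[OF \<open>open ?N\<close> open_UNIV subset_UNIV this(2,1)]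
      have "Ck_on k ?N (\<lambda>y. u ((\<psi> \<circ> inv_into V \<theta>) y))" .
      then have "Ck_on k ?N (?u \<circ> inv_into V \<theta>)"
        by (rule Ck_on_cong[OF \<open>open ?N\<close>, rotated]) (auto simp: inv)
      moreover have "x \<in> ?N" using q True by simp
      ultimately show ?thesis using \<open>open ?N\<close> by blast
    next
      case False
      let ?N = "\<theta> ` (V \<inter> - ?K)"
      have "open ?N" using chart_image_open[OF d open_Compl[OF K]] .
      have "Ck_on k ?N (?u \<circ> inv_into V \<theta>)"
      proof (rule Ck_on_cong[OF \<open>open ?N\<close> _ Ck_on_const[of _ _ 0]])
        fix y assume "y \<in> ?N"
        then obtain s where s: "s \<in> V" "s \<notin> ?K" "y = \<theta> s" by blast
        then have "inv_into V \<theta> y = s" using inv by simp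
        with z'[OF s(2)] show "0 = (?u \<circ> inv_into V \<theta>) y" by (auto split: if_splits)
      qed
      moreover have "q \<notin> ?K" using False KU by (rule contra_subsetD[rotated])
      then have "x \<in> ?N" using q by simp
      ultimately show ?thesis using \<open>open ?N\<close> by blast
    qed
  qed
  then show ?thesis unfolding smooth_functions_iff by blast
qed

section \<open>Derivations at a point\<close>

lemma tangent_add: "v \<in> tangent_space \<A> p \<Longrightarrow> w \<in> tangent_space \<A> p \<Longrightarrow> v + w \<in> tangent_space \<A> p"
  by (simp add: tangent_space_def algebra_simps)

lemma tangent_scaleR: "v \<in> tangent_space \<A> p \<Longrightarrow> c *\<^sub>R v \<in> tangent_space \<A> p"
  by (simp add: tangent_space_def scaleR_fun_def algebra_simps)

lemma tangent_zero: "0 \<in> tangent_space \<A> p"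
  by (simp add: tangent_space_def)

lemma subspace_tangent: "subspace (tangent_space \<A> p)"
  by (simp add: subspace_def tangent_add tangent_scaleR tangent_zero)

lemma tangentD:
  assumes "v \<in> tangent_space \<A> p" "f \<in> smooth_functions \<A>"
  shows "g \<in> smooth_functions \<A> \<Longrightarrow> v (f + g) = v f + v g"
    and "v (c *\<^sub>R f) = c * v f"
    and "g \<in> smooth_functions \<A> \<Longrightarrow> v (f * g) = f p * v g + g p * v f"
  using assms by (auto simp: tangent_space_def)

lemma tangent_nonsmooth: "v \<in> tangent_space \<A> p \<Longrightarrow> f \<notin> smooth_functions \<A> \<Longrightarrow> v f = 0"
  by (auto simp: tangent_space_def)

lemma tangent_const:
  assumes "v \<in> tangent_space \<A> p"
  shows "v (\<lambda>_. c) = 0"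
proof -
  have "v ((\<lambda>_. 1) * (\<lambda>_. 1)) = 1 * v (\<lambda>_. 1) + 1 * v (\<lambda>_. 1)"
    using tangentD(3)[OF assms smooth_const smooth_const, of 1 1] by simp
  then have "v (\<lambda>_. 1) = 0" by (simp add: times_fun_def)
  moreover have "(\<lambda>_::'a. c) = c *\<^sub>R (\<lambda>_. 1)" by (simp add: scaleR_fun_def)
  ultimately show ?thesis using tangentD(2)[OF assms smooth_const, of c 1] by simp
qed

lemma tangent_sum:
  assumes "v \<in> tangent_space \<A> p" "\<And>i. i \<in> I \<Longrightarrow> f i \<in> smooth_functions \<A>"
  shows "(\<Sum>i\<in>I. f i) \<in> smooth_functions \<A> \<and> v (\<Sum>i\<in>I. f i) = (\<Sum>i\<in>I. v (f i))"
proof -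
  have z: "v 0 = 0" "0 \<in> smooth_functions \<A>"
    using tangent_const[OF assms(1), of 0] smooth_const[of 0] by (simp_all add: zero_fun_def)
  show ?thesis
    using assms(2) by (induction I rule: infinite_finite_induct)
      (auto simp: z tangentD(1)[OF assms(1)] intro: smooth_add)
qed

text \<open>The value 0 off the smooth functions is forced by the last clause of
  \<open>tangent_space\<close>.\<close>

definition coord_vec :: "'a set \<Rightarrow> ('a \<Rightarrow> 'e) \<Rightarrow> 'a \<Rightarrow> 'e \<Rightarrow> 'a tvec" where
  "coord_vec U \<psi> q e f =
     (if f \<in> smooth_functions \<A> then frechet_derivative (f \<circ> inv_into U \<psi>) (at (\<psi> q)) e else 0)"

lemma chart_has_derivative:
  assumes "(U, \<psi>) \<in> \<A>" "q \<in> U" "f \<in> smooth_functions \<A>"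
  shows "((f \<circ> inv_into U \<psi>) has_derivative frechet_derivative (f \<circ> inv_into U \<psi>) (at (\<psi> q))) (at (\<psi> q))"
  using Ck_on_Suc_has_derivative[OF smooth_functionsD[OF assms(3,1)]] assms(2) by (simp add: o_def)

lemma linear_coord_vec:
  assumes "(U, \<psi>) \<in> \<A>" "q \<in> U"
  shows "linear (coord_vec U \<psi> q)"
proof -
  have "linear (frechet_derivative (f \<circ> inv_into U \<psi>) (at (\<psi> q)))" if "f \<in> smooth_functions \<A>" for f
    using chart_has_derivative[OF assms that] has_derivative_linear by blast
  then show ?thesis
    by (intro linearI) (auto simp: coord_vec_def fun_eq_iff scaleR_fun_def linear_add linear_scale)
qed

lemma coord_vec_tangent:
  assumes c: "(U, \<psi>) \<in> \<A>" "q \<in> U"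
  shows "coord_vec U \<psi> q e \<in> tangent_space \<A> q"
proof -
  note d = chart_has_derivative[OF c]
  have i: "inv_into U \<psi> (\<psi> q) = q" using inv_into_f_f[OF chart_props(3)] c by blast
  have add: "frechet_derivative ((f + g) \<circ> inv_into U \<psi>) (at (\<psi> q)) e =
      frechet_derivative (f \<circ> inv_into U \<psi>) (at (\<psi> q)) e + frechet_derivative (g \<circ> inv_into U \<psi>) (at (\<psi> q)) e"
    if "f \<in> smooth_functions \<A>" "g \<in> smooth_functions \<A>" for f g
    using frechet_derivative_at[OF has_derivative_add[OF d d], OF that] by (simp add: o_def fun_eq_iff)
  have mult: "frechet_derivative ((f * g) \<circ> inv_into U \<psi>) (at (\<psi> q)) e =
      f q * frechet_derivative (g \<circ> inv_into U \<psi>) (at (\<psi> q)) e + g q * frechet_derivative (f \<circ> inv_into U \<psi>) (at (\<psi> q)) e"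
    if "f \<in> smooth_functions \<A>" "g \<in> smooth_functions \<A>" for f g
    using frechet_derivative_at[OF has_derivative_mult[OF d d], OF that] by (simp add: o_def fun_eq_iff i mult.commute)
  have scale: "frechet_derivative ((s *\<^sub>R f) \<circ> inv_into U \<psi>) (at (\<psi> q)) e =
      s * frechet_derivative (f \<circ> inv_into U \<psi>) (at (\<psi> q)) e"
    if "f \<in> smooth_functions \<A>" for f s
    using frechet_derivative_at[OF has_derivative_scaleR_right[OF d], OF that] by (simp add: o_def scaleR_fun_def fun_eq_iff)
  show ?thesis
    by (auto simp: tangent_space_def coord_vec_def add mult scale smooth_add smooth_mult smooth_scaleR)
qed

lemma chart_bump:
  assumes c: "(U, \<psi>) \<in> \<A>" "p \<in> U"
  obtains r R \<beta> where "0 < r" "r < R" "ball (\<psi> p) R \<subseteq> \<psi> ` U" "cball (\<psi> p) r \<subseteq> ball (\<psi> p) R"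
    "smooth_on UNIV \<beta>" "\<beta> (\<psi> p) = (1::real)" "\<And>y. y \<notin> cball (\<psi> p) r \<Longrightarrow> \<beta> y = 0"
proof -
  obtain R where R: "R > 0" "ball (\<psi> p) R \<subseteq> \<psi> ` U"
    using chart_props(2)[OF c(1)] c(2) open_contains_ball by blast
  obtain \<beta> :: "'e \<Rightarrow> real" where "smooth_on UNIV \<beta>" "\<beta> (\<psi> p) = 1" "\<And>y. y \<notin> cball (\<psi> p) (R/2) \<Longrightarrow> \<beta> y = 0"
    using smooth_bump[of "R/2" "\<psi> p"] R(1) by auto
  with that[of "R/2" R \<beta>] R show ?thesis by (auto simp: cball_subset_ball_iff)
qed

text \<open>A bump function with value 1 at \<open>p\<close> turns the coordinate vectors of a chart
  into a global field without changing the vector at \<open>p\<close>.\<close>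

lemma coord_field:
  assumes c: "(U, \<psi>) \<in> \<A>" "p \<in> U"
  shows "\<exists>X\<in>vector_fields \<A>. X p = coord_vec U \<psi> p e"
proof -
  obtain r R \<beta> where b: "0 < r" "r < R" "ball (\<psi> p) R \<subseteq> \<psi> ` U" "cball (\<psi> p) r \<subseteq> ball (\<psi> p) R"
    "smooth_on UNIV \<beta>" "\<beta> (\<psi> p) = (1::real)" "\<And>y. y \<notin> cball (\<psi> p) r \<Longrightarrow> \<beta> y = 0"
    using chart_bump[OF c] by metis
  define X where "X q = (if q \<in> U then \<beta> (\<psi> q) *\<^sub>R coord_vec U \<psi> q e else 0)" for q
  have "X q \<in> tangent_space \<A> q" for q
    using coord_vec_tangent[OF c(1)] tangent_scaleR tangent_zero by (simp add: X_def)
  moreover have "(\<lambda>q. X q f) \<in> smooth_functions \<A>" if f: "f \<in> smooth_functions \<A>" for f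
  proof -
    let ?d = "\<lambda>y. frechet_derivative (f \<circ> inv_into U \<psi>) (at y) e"
    have "smooth_on (\<psi> ` U) (f \<circ> inv_into U \<psi>)" using f c by (auto simp: smooth_functions_iff)
    then have "smooth_on (\<psi> ` U) ?d"
      by (rule smooth_on_frechet_derivative)
    then have "smooth_on UNIV (\<lambda>y. \<beta> y * ?d y)"
      using b by (intro smooth_cutoff[OF chart_props(2)[OF c(1)]]) auto
    then have "(\<lambda>q. if q \<in> U then \<beta> (\<psi> q) * ?d (\<psi> q) else 0) \<in> smooth_functions \<A>"
      by (rule smooth_extend_zero[OF c(1), of _ "\<psi> p" r]) (use b in auto)
    moreover have "(\<lambda>q. if q \<in> U then \<beta> (\<psi> q) * ?d (\<psi> q) else 0) = (\<lambda>q. X q f)"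
      using f by (auto simp: X_def coord_vec_def scaleR_fun_def)
    ultimately show ?thesis by simp
  qed
  ultimately have "X \<in> vector_fields \<A>" by (simp add: vector_fields_def)
  moreover have "X p = coord_vec U \<psi> p e" using c b by (simp add: X_def)
  ultimately show ?thesis by blast
qed

text \<open>The cut-off function \<open>\<beta>\<close> need not be constant near \<open>p\<close>: as \<open>\<beta>(p) = 1\<close>, a derivation takes the same
  value on \<open>\<beta>\<^sup>2 (f - f(p))\<close> as on \<open>f\<close>.\<close>

lemma tangent_eq_coord_vec:
  assumes c: "(U, \<psi>) \<in> \<A>" "p \<in> U" and v: "v \<in> tangent_space \<A> p"
  shows "\<exists>e. v = coord_vec U \<psi> p e"
proof -
  obtain r R \<beta> where b: "0 < r" "r < R" "ball (\<psi> p) R \<subseteq> \<psi> ` U" "cball (\<psi> p) r \<subseteq> ball (\<psi> p) R"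
    "smooth_on UNIV \<beta>" "\<beta> (\<psi> p) = (1::real)" "\<And>y. y \<notin> cball (\<psi> p) r \<Longrightarrow> \<beta> y = 0"
    using chart_bump[OF c] by metis
  let ?a = "\<psi> p"
  define ext where "ext u = (\<lambda>q. if q \<in> U then \<beta> (\<psi> q) * u (\<psi> q) else 0)" for u :: "'e \<Rightarrow> real"
  have ext: "ext u \<in> smooth_functions \<A>" if "smooth_on (ball ?a R) u" for u
    using smooth_extend_zero[OF c(1), of "\<lambda>y. \<beta> y * u y" ?a r] smooth_cutoff[OF open_ball that] b
    unfolding ext_def by auto
  let ?x = "\<lambda>b. ext (\<lambda>y. (y - ?a) \<bullet> b)"
  define e where "e = (\<Sum>b\<in>Basis. v (?x b) *\<^sub>R b)"
  have xs: "?x b \<in> smooth_functions \<A>" for b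
    by (rule ext[OF smooth_on_inner_diff[OF open_ball]])
  have x0: "?x b p = 0" for b by (simp add: ext_def)
  have "v f = coord_vec U \<psi> p e f" for f
  proof (cases "f \<in> smooth_functions \<A>")
    case True
    let ?F = "f \<circ> inv_into U \<psi>"
    have i: "inv_into U \<psi> (\<psi> q) = q" if "q \<in> U" for q
      using inv_into_f_f[OF chart_props(3)[OF c(1)] that] .
    have "smooth_on (ball ?a R) ?F"
      using Ck_on_subset[OF smooth_functionsD[OF True c(1)] b(3)] by (simp add: smooth_on_def o_def)
    from hadamard[OF this less_trans[OF b(1,2)]]
    obtain G where G: "\<And>b. smooth_on (ball ?a R) (G b)"
      "\<And>b. G b ?a = frechet_derivative ?F (at ?a) b"
      "\<And>x. x \<in> ball ?a R \<Longrightarrow> ?F x = ?F ?a + (\<Sum>b\<in>Basis. ((x - ?a) \<bullet> b) * G b x)"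
      by blast
    let ?\<beta> = "ext (\<lambda>_. 1)"
    let ?f = "f + (\<lambda>_. - f p)"
    have B: "?\<beta> \<in> smooth_functions \<A>" by (rule ext) (simp add: smooth_on_def)
    have B1: "?\<beta> p = 1" using c b by (simp add: ext_def)
    have f0: "?f \<in> smooth_functions \<A>" by (intro smooth_add True smooth_const)
    \<comment> \<open>Hadamard's formula, with one factor \<beta> given to the coordinate and the
      other to the remainder, so that every factor is a global smooth function. As
      \<open>?x b\<close> vanishes at \<open>p\<close>, the Leibniz rule later keeps only one term
      of each product.\<close>
    have eq: "(?\<beta> * ?\<beta>) * ?f = (\<Sum>b\<in>Basis. ?x b * ext (G b))"
    proof
      fix q
      show "((?\<beta> * ?\<beta>) * ?f) q = (\<Sum>b\<in>Basis. ?x b * ext (G b)) q"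
      proof (cases "q \<in> U \<and> \<psi> q \<in> cball ?a r")
        case T: True
        then have "f q = f p + (\<Sum>b\<in>Basis. ((\<psi> q - ?a) \<bullet> b) * G b (\<psi> q))"
          using G(3)[of "\<psi> q"] i c b(4) by auto
        then show ?thesis using T
          by (simp add: sum_apply ext_def sum_distrib_left algebra_simps)
      next
        case False
        then have "?\<beta> q = 0" "ext (G b) q = 0" for b using b by (auto simp: ext_def)
        then show ?thesis by (simp add: sum_apply)
      qed
    qed
    have "v ((?\<beta> * ?\<beta>) * ?f) = v ?f"
      using tangentD(3)[OF v smooth_mult[OF B B] f0] B1 by simp
    also have "\<dots> = v f" using tangentD(1)[OF v True smooth_const] tangent_const[OF v] by simp
    finally have "v f = (\<Sum>b\<in>Basis. v (?x b * ext (G b)))"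
      unfolding eq using tangent_sum[OF v, of Basis "\<lambda>b. ?x b * ext (G b)"] smooth_mult xs ext G by simp
    also have "\<dots> = (\<Sum>b\<in>Basis. v (?x b) * frechet_derivative ?F (at ?a) b)"
      by (rule sum.cong) (use tangentD(3)[OF v xs ext[OF G(1)]] x0 c b G(2) in \<open>auto simp: ext_def\<close>)
    also have "\<dots> = frechet_derivative ?F (at ?a) e"
      using has_derivative_linear[OF chart_has_derivative[OF c True]]
      by (simp add: e_def linear_sum linear_scale)
    finally show ?thesis using True by (simp add: coord_vec_def)
  qed (use v tangent_nonsmooth in \<open>auto simp: coord_vec_def\<close>)
  then show ?thesis by blast
qed

text \<open>A cut-off linear function with gradient \<open>e\<close> detects \<open>e\<close>. The
  derivative of the bump does not contribute, since the linear factor vanishes at the point.\<close>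

lemma inj_coord_vec:
  assumes c: "(U, \<psi>) \<in> \<A>" "p \<in> U"
  shows "inj (coord_vec U \<psi> p)"
proof -
  obtain r R \<beta> where b: "0 < r" "r < R" "ball (\<psi> p) R \<subseteq> \<psi> ` U" "cball (\<psi> p) r \<subseteq> ball (\<psi> p) R"
    "smooth_on UNIV \<beta>" "\<beta> (\<psi> p) = (1::real)" "\<And>y. y \<notin> cball (\<psi> p) r \<Longrightarrow> \<beta> y = 0"
    using chart_bump[OF c] by metis
  let ?a = "\<psi> p"
  have "e = 0" if e: "coord_vec U \<psi> p e = 0" for e
  proof -
    let ?l = "\<lambda>y. (y - ?a) \<bullet> e"
    let ?f = "\<lambda>q. if q \<in> U then \<beta> (\<psi> q) * ?l (\<psi> q) else 0"
    have "smooth_on UNIV ?l" by (rule smooth_on_inner_diff[OF open_UNIV])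
    then have "smooth_on UNIV (\<lambda>y. \<beta> y * ?l y)"
      using b by (intro smooth_cutoff[OF open_UNIV]) auto
    then have f: "?f \<in> smooth_functions \<A>"
      by (rule smooth_extend_zero[OF c(1), of _ ?a r]) (use b in auto)
    have "(\<beta> has_derivative frechet_derivative \<beta> (at ?a)) (at ?a)"
      using Ck_on_Suc_has_derivative[of 0 UNIV \<beta>] b(5) by (simp add: smooth_on_def del: Ck_on.simps)
    moreover have "(?l has_derivative (\<lambda>v. v \<bullet> e)) (at ?a)"
      by (auto intro!: derivative_eq_intros)
    ultimately have "((\<lambda>y. \<beta> y * ?l y) has_derivative (\<lambda>v. v \<bullet> e)) (at ?a)"
      using has_derivative_mult b(6) by fastforce
    then have "((?f \<circ> inv_into U \<psi>) has_derivative (\<lambda>v. v \<bullet> e)) (at ?a)"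
      by (rule has_derivative_transform_within_open[OF _ chart_props(2)[OF c(1)]])
        (use c inv_into_f_f[OF chart_props(3)[OF c(1)]] in auto)
    from frechet_derivative_at[OF this] have "coord_vec U \<psi> p e ?f = e \<bullet> e"
      using f by (simp add: coord_vec_def fun_eq_iff)
    with e show "e = 0" by simp
  qed
  then show ?thesis using linear_coord_vec[OF c] linear_injective_0 by blast
qed

text \<open>Tangent spaces sit inside a space of functionals. This copy of \<open>'e\<close>
  supplies the finite-dimensional facts: injective maps are onto, and bases have
  \<open>DIM('e)\<close> elements.\<close>

theorem tangent_space_coords:
  "\<exists>L::'e \<Rightarrow> 'a tvec. linear L \<and> inj L \<and> range L = tangent_space \<A> p"
proof -
  obtain U \<psi> where c: "(U, \<psi>) \<in> \<A>" "p \<in> U" using chart_at by blast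
  have "range (coord_vec U \<psi> p) = tangent_space \<A> p"
    using coord_vec_tangent[OF c] tangent_eq_coord_vec[OF c] by blast
  then show ?thesis using linear_coord_vec[OF c] inj_coord_vec[OF c] by blast
qed

theorem tangent_extends: "v \<in> tangent_space \<A> p \<Longrightarrow> \<exists>X\<in>vector_fields \<A>. X p = v"
  using chart_at[of p] tangent_eq_coord_vec coord_field by metis

end

section \<open>Exterior derivatives through the Levi-Civita connection\<close>

lemma vderiv_apply: "vderiv X f p = X p f" by (simp add: vderiv_def)

lemma tapply_apply: "tapply T X p = T p (X p)" by (simp add: tapply_def)

lemma tapply2_apply: "tapply2 b X Y p = b p (X p) (Y p)" by (simp add: tapply2_def)

lemma fmult_apply: "fmult f X p = f p *\<^sub>R X p" by (simp add: fmult_def)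

locale riemannian_manifold =
  fixes \<A> :: "('a::{t2_space, second_countable_topology}, 'e::euclidean_space) chart set"
    and g :: "'a tensor02" and D :: "'a conn"
  assumes atlas: "smooth_atlas \<A>"
    and metric: "riemannian_metric \<A> g"
    and levi_civita: "levi_civita \<A> g D"
begin

abbreviation VF :: "'a vfield set" where "VF \<equiv> vector_fields \<A>"
abbreviation SF :: "('a \<Rightarrow> real) set" where "SF \<equiv> smooth_functions \<A>"
abbreviation TS :: "'a \<Rightarrow> 'a tvec set" where "TS p \<equiv> tangent_space \<A> p"
abbreviation ip :: "'a vfield \<Rightarrow> 'a vfield \<Rightarrow> 'a \<Rightarrow> real" where "ip \<equiv> tapply2 g"
abbreviation br :: "'a vfield \<Rightarrow> 'a vfield \<Rightarrow> 'a vfield" where "br \<equiv> lie_bracket"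

lemma TS_simps [simp]:
  "u \<in> TS p \<Longrightarrow> v \<in> TS p \<Longrightarrow> u + v \<in> TS p" "u \<in> TS p \<Longrightarrow> c *\<^sub>R u \<in> TS p"
  "0 \<in> TS p" "u \<in> TS p \<Longrightarrow> - u \<in> TS p" "u \<in> TS p \<Longrightarrow> v \<in> TS p \<Longrightarrow> u - v \<in> TS p"
  using subspace_tangent[OF atlas, of p]
  by (simp_all add: subspace_add subspace_scale subspace_0 subspace_neg subspace_diff)

lemma VF_TS [simp]: "X \<in> VF \<Longrightarrow> X p \<in> TS p"
  by (simp add: vector_fields_def)

lemma VF_ext: "u \<in> TS p \<Longrightarrow> \<exists>X\<in>VF. X p = u"
  by (rule tangent_extends[OF atlas])

lemma SF_simps [simp]:
  "f \<in> SF \<Longrightarrow> f' \<in> SF \<Longrightarrow> f + f' \<in> SF" "(\<lambda>_. c) \<in> SF" "0 \<in> SF" "1 \<in> SF" "f \<in> SF \<Longrightarrow> - f \<in> SF"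
  "f \<in> SF \<Longrightarrow> f' \<in> SF \<Longrightarrow> f - f' \<in> SF"
proof -
  show *: "f + f' \<in> SF" if "f \<in> SF" "f' \<in> SF" for f f' using that by (rule smooth_add[OF atlas])
  show "(\<lambda>_. c) \<in> SF" for c by (rule smooth_const[OF atlas])
  then show "0 \<in> SF" "1 \<in> SF" by (simp_all add: zero_fun_def one_fun_def)
  show m: "- f \<in> SF" if "f \<in> SF" for f
  proof -
    have "(- 1) *\<^sub>R f = - f" by (rule ext) (simp add: scaleR_fun_def)
    then show ?thesis using smooth_scaleR[OF atlas that, of "-1"] by metis
  qed
  show "f - f' \<in> SF" if "f \<in> SF" "f' \<in> SF" for f f'
    using *[OF that(1) m[OF that(2)]] by (simp only: diff_conv_add_uminus)
qed

lemma vderiv_SF [simp]: "X \<in> VF \<Longrightarrow> f \<in> SF \<Longrightarrow> vderiv X f \<in> SF"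
  unfolding vector_fields_def vderiv_def by blast

lemma VF_I: "(\<And>p. X p \<in> TS p) \<Longrightarrow> (\<And>f. f \<in> SF \<Longrightarrow> (\<lambda>p. X p f) \<in> SF) \<Longrightarrow> X \<in> VF"
  unfolding vector_fields_def by blast

lemma VF_add [simp]:
  assumes "X \<in> VF" "Y \<in> VF" shows "X + Y \<in> VF"
proof -
  have "(\<lambda>p. (X + Y) p f) \<in> SF" if "f \<in> SF" for f
    using SF_simps(1)[OF vderiv_SF[OF assms(1) that] vderiv_SF[OF assms(2) that]]
    by (simp add: vderiv_def plus_fun_def)
  then show ?thesis using assms by (intro VF_I) auto
qed

lemma VF_fmult [simp]:
  assumes "X \<in> VF" "f \<in> SF" shows "fmult f X \<in> VF"
proof -
  have "(\<lambda>p. fmult f X p u) \<in> SF" if "u \<in> SF" for u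
    using smooth_mult[OF atlas assms(2) vderiv_SF[OF assms(1) that]]
    by (simp add: vderiv_def times_fun_def fmult_def scaleR_fun_def)
  then show ?thesis using assms by (intro VF_I) (auto simp: fmult_apply)
qed

lemma VF_minus [simp]:
  assumes "X \<in> VF" shows "- X \<in> VF"
proof -
  have "fmult (\<lambda>_. -1) X = - X" by (intro ext) (simp add: fmult_def scaleR_fun_def)
  then show ?thesis using VF_fmult[OF assms SF_simps(2)] by metis
qed

lemma VF_diff [simp]: "X \<in> VF \<Longrightarrow> Y \<in> VF \<Longrightarrow> X - Y \<in> VF"
  using VF_add[of X "- Y"] by simp

lemma VF_zero [simp]: "0 \<in> VF"
  using SF_simps(2)[of 0] by (intro VF_I) simp_all

lemma vderiv_add [simp]: "X \<in> VF \<Longrightarrow> f \<in> SF \<Longrightarrow> f' \<in> SF \<Longrightarrow> vderiv X (f + f') = vderiv X f + vderiv X f'"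
  using tangentD(1)[OF atlas VF_TS] by (simp add: vderiv_def fun_eq_iff)

lemma vderiv_const [simp]: "X \<in> VF \<Longrightarrow> vderiv X (\<lambda>_. c) = 0" "X \<in> VF \<Longrightarrow> vderiv X 0 = 0" "X \<in> VF \<Longrightarrow> vderiv X 1 = 0"
  using tangent_const[OF atlas VF_TS] by (simp_all add: vderiv_def fun_eq_iff zero_fun_def one_fun_def)

lemma vderiv_minus [simp]:
  assumes "X \<in> VF" "f \<in> SF" shows "vderiv X (- f) = - vderiv X f"
  using vderiv_add[OF assms(1), of f "- f"] assms by (simp add: eq_neg_iff_add_eq_0 add.commute)

lemma vderiv_diff [simp]: "X \<in> VF \<Longrightarrow> f \<in> SF \<Longrightarrow> f' \<in> SF \<Longrightarrow> vderiv X (f - f') = vderiv X f - vderiv X f'"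
  using vderiv_add[of X f "- f'"] by simp

lemma affine: "affine_connection \<A> D" using levi_civita by (simp add: levi_civita_def)

lemma D_VF [simp]: "X \<in> VF \<Longrightarrow> Y \<in> VF \<Longrightarrow> D X Y \<in> VF"
  using affine by (simp add: affine_connection_def)

lemma D_add_left: "X \<in> VF \<Longrightarrow> Y \<in> VF \<Longrightarrow> Z \<in> VF \<Longrightarrow> D (X + Y) Z = D X Z + D Y Z"
  using affine by (simp add: affine_connection_def)

lemma D_add_right: "X \<in> VF \<Longrightarrow> Y \<in> VF \<Longrightarrow> Z \<in> VF \<Longrightarrow> D X (Y + Z) = D X Y + D X Z"
  using affine by (simp add: affine_connection_def)

lemma D_fmult_left: "X \<in> VF \<Longrightarrow> Y \<in> VF \<Longrightarrow> f \<in> SF \<Longrightarrow> D (fmult f X) Y = fmult f (D X Y)"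
  using affine by (simp add: affine_connection_def)

lemma D_fmult_right: "X \<in> VF \<Longrightarrow> Y \<in> VF \<Longrightarrow> f \<in> SF \<Longrightarrow> D X (fmult f Y) = fmult (vderiv X f) Y + fmult f (D X Y)"
  using affine by (simp add: affine_connection_def)

lemma D_zero_right: "X \<in> VF \<Longrightarrow> D X 0 = 0"
  using D_add_right[of X 0 0] by simp

lemma D_zero_left: "Y \<in> VF \<Longrightarrow> D 0 Y = 0"
  using D_add_left[of 0 0 Y] by simp

lemma D_minus_right: "X \<in> VF \<Longrightarrow> Y \<in> VF \<Longrightarrow> D X (- Y) = - D X Y"
  using D_add_right[of X Y "- Y"] D_zero_right by (simp add: eq_neg_iff_add_eq_0 add.commute)

lemma D_minus_left: "X \<in> VF \<Longrightarrow> Y \<in> VF \<Longrightarrow> D (- X) Y = - D X Y"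
  using D_add_left[of X "- X" Y] D_zero_left by (simp add: eq_neg_iff_add_eq_0 add.commute)

lemma D_diff_right: "X \<in> VF \<Longrightarrow> Y \<in> VF \<Longrightarrow> Z \<in> VF \<Longrightarrow> D X (Y - Z) = D X Y - D X Z"
  using D_add_right[of X Y "- Z"] D_minus_right by simp

lemma D_diff_left: "X \<in> VF \<Longrightarrow> Y \<in> VF \<Longrightarrow> Z \<in> VF \<Longrightarrow> D (X - Y) Z = D X Z - D Y Z"
  using D_add_left[of X "- Y" Z] D_minus_left by simp

lemma torsion_free: "X \<in> VF \<Longrightarrow> Y \<in> VF \<Longrightarrow> br X Y = D X Y - D Y X"
  using levi_civita by (simp add: levi_civita_def)

lemma br_VF [simp]: "X \<in> VF \<Longrightarrow> Y \<in> VF \<Longrightarrow> br X Y \<in> VF"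
  by (simp add: torsion_free)

lemma metric_compatible: "X \<in> VF \<Longrightarrow> Y \<in> VF \<Longrightarrow> Z \<in> VF \<Longrightarrow> vderiv X (ip Y Z) = ip (D X Y) Z + ip Y (D X Z)"
  using levi_civita by (simp add: levi_civita_def)

lemma ip_SF [simp]: "X \<in> VF \<Longrightarrow> Y \<in> VF \<Longrightarrow> ip X Y \<in> SF"
  using metric by (simp add: riemannian_metric_def)

lemma g_sym: "u \<in> TS p \<Longrightarrow> v \<in> TS p \<Longrightarrow> g p u v = g p v u"
  using metric by (simp add: riemannian_metric_def)

lemma g_add:
  assumes "u \<in> TS p" "v \<in> TS p" "w \<in> TS p"
  shows "g p u (v + w) = g p u v + g p u w" "g p (v + w) u = g p v u + g p w u"
proof -
  show *: "g p u (v + w) = g p u v + g p u w"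
    using metric assms by (simp add: riemannian_metric_def linear_on_space_def)
  show "g p (v + w) u = g p v u + g p w u"
    using * assms g_sym[of u p] by simp
qed

lemma g_scale:
  assumes "u \<in> TS p" "v \<in> TS p"
  shows "g p u (c *\<^sub>R v) = c * g p u v" "g p (c *\<^sub>R v) u = c * g p v u"
proof -
  show *: "g p u (c *\<^sub>R v) = c * g p u v"
    using metric assms by (simp add: riemannian_metric_def linear_on_space_def)
  show "g p (c *\<^sub>R v) u = c * g p v u"
    using * assms g_sym[of u p] by simp
qed

lemma g_minus:
  assumes "u \<in> TS p" "v \<in> TS p"
  shows "g p u (- v) = - g p u v" "g p (- v) u = - g p v u"
  using g_scale[OF assms, of "-1"] by simp_all

lemma g_zero:
  assumes "u \<in> TS p"
  shows "g p u 0 = 0" "g p 0 u = 0"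
  using g_scale[OF assms, of 0 0] by simp_all

lemma g_diff:
  assumes "u \<in> TS p" "v \<in> TS p" "w \<in> TS p"
  shows "g p u (v - w) = g p u v - g p u w" "g p (v - w) u = g p v u - g p w u"
  using assms g_add[of u p v "- w"] g_minus[of u p w] by simp_all

lemmas g_lin = g_add g_scale g_minus g_zero g_diff

lemma g_pos: "u \<in> TS p \<Longrightarrow> u \<noteq> 0 \<Longrightarrow> g p u u > 0"
  using metric by (simp add: riemannian_metric_def)

lemma g_nondegenerate:
  assumes "u \<in> TS p" "\<And>v. v \<in> TS p \<Longrightarrow> g p u v = 0" shows "u = 0"
  using g_pos[OF assms(1)] assms(2)[OF assms(1)] by auto

lemma ip_sym: "X \<in> VF \<Longrightarrow> Y \<in> VF \<Longrightarrow> ip X Y = ip Y X"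
  by (rule ext) (simp add: tapply2_apply g_sym)

lemma ip_lin:
  "X \<in> VF \<Longrightarrow> Y \<in> VF \<Longrightarrow> Z \<in> VF \<Longrightarrow> ip X (Y + Z) = ip X Y + ip X Z"
  "X \<in> VF \<Longrightarrow> Y \<in> VF \<Longrightarrow> Z \<in> VF \<Longrightarrow> ip (Y + Z) X = ip Y X + ip Z X"
  "X \<in> VF \<Longrightarrow> Y \<in> VF \<Longrightarrow> Z \<in> VF \<Longrightarrow> ip X (Y - Z) = ip X Y - ip X Z"
  "X \<in> VF \<Longrightarrow> Y \<in> VF \<Longrightarrow> Z \<in> VF \<Longrightarrow> ip (Y - Z) X = ip Y X - ip Z X"
  "X \<in> VF \<Longrightarrow> Y \<in> VF \<Longrightarrow> ip (- Y) X = - ip Y X"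
  "X \<in> VF \<Longrightarrow> Y \<in> VF \<Longrightarrow> ip X (- Y) = - ip X Y"
  "X \<in> VF \<Longrightarrow> ip 0 X = 0" "X \<in> VF \<Longrightarrow> ip X 0 = 0"
  by (rule ext; simp add: tapply2_apply g_lin)+

lemma ip_fmult:
  "X \<in> VF \<Longrightarrow> Y \<in> VF \<Longrightarrow> ip (fmult f Y) X = f * ip Y X"
  "X \<in> VF \<Longrightarrow> Y \<in> VF \<Longrightarrow> ip X (fmult f Y) = f * ip X Y"
  by (rule ext; simp add: tapply2_apply fmult_apply g_lin)+

lemma VF_eqI:
  assumes "X \<in> VF" "Y \<in> VF" "\<And>Z p. Z \<in> VF \<Longrightarrow> ip X Z p = ip Y Z p"
  shows "X = Y"
proof
  fix p
  have "X p - Y p = 0"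
  proof (rule g_nondegenerate[of _ p])
    show "X p - Y p \<in> TS p" using assms by simp
    fix v assume "v \<in> TS p"
    then obtain Z where "Z \<in> VF" "Z p = v" using VF_ext by blast
    then show "g p (X p - Y p) v = 0"
      using assms(3)[of Z p] assms(1,2) VF_TS by (auto simp: tapply2_apply g_lin)
  qed
  then show "X p = Y p" by simp
qed

lemma tensor_at:
  assumes "is_tensor11 \<A> S" "u \<in> TS p"
  shows "S p u \<in> TS p" "v \<in> TS p \<Longrightarrow> S p (u + v) = S p u + S p v" "S p (c *\<^sub>R u) = c *\<^sub>R S p u"
    "S p (- u) = - S p u" "v \<in> TS p \<Longrightarrow> S p (u - v) = S p u - S p v" "S p 0 = 0"
proof -
  show "S p u \<in> TS p" using assms by (auto simp: is_tensor11_def)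
  have add: "S p (u + v) = S p u + S p v" if "u \<in> TS p" "v \<in> TS p" for u v
    using assms(1) that by (simp add: is_tensor11_def linear_on_space_def)
  have scale: "S p (c *\<^sub>R u) = c *\<^sub>R S p u" if "u \<in> TS p" for c u
    using assms(1) that by (simp add: is_tensor11_def linear_on_space_def)
  have minus: "S p (- u) = - S p u" if "u \<in> TS p" for u
    using scale[OF that, of "-1"] by simp
  show "v \<in> TS p \<Longrightarrow> S p (u - v) = S p u - S p v"
    using add[of u "- v"] minus assms(2) by simp
  show "S p 0 = 0" using scale[of 0 0] by simp
  show "v \<in> TS p \<Longrightarrow> S p (u + v) = S p u + S p v" "S p (c *\<^sub>R u) = c *\<^sub>R S p u" "S p (- u) = - S p u"
    using add scale minus assms(2) by blast+
qed

lemma tensor_VF: "is_tensor11 \<A> S \<Longrightarrow> X \<in> VF \<Longrightarrow> tapply S X \<in> VF"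
  by (simp add: is_tensor11_def)

lemma tensor_lin:
  assumes "is_tensor11 \<A> S" "X \<in> VF"
  shows "Y \<in> VF \<Longrightarrow> tapply S (X + Y) = tapply S X + tapply S Y"
    "Y \<in> VF \<Longrightarrow> tapply S (X - Y) = tapply S X - tapply S Y" "tapply S (- X) = - tapply S X"
    "tapply S (fmult f X) = fmult f (tapply S X)"
  using assms by (auto intro!: ext[where 'a='a] simp: tapply_apply fmult_apply tensor_at)

lemma tensor_zero: "is_tensor11 \<A> S \<Longrightarrow> tapply S 0 = 0"
  using tensor_at(6)[of S 0] by (auto intro!: ext[where 'a='a] simp: tapply_apply)

section \<open>Covariant derivatives of (1,1)-tensors\<close>

lemma cov_deriv_VF [simp]:
  "is_tensor11 \<A> S \<Longrightarrow> X \<in> VF \<Longrightarrow> Y \<in> VF \<Longrightarrow> cov_deriv D X S Y \<in> VF"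
  by (simp add: cov_deriv_def tensor_VF)

lemma cov_deriv_form:
  assumes "is_tensor11 \<A> S" "X \<in> VF" "Y \<in> VF" "Z \<in> VF"
  shows "ip (cov_deriv D X S Y) Z
    = vderiv X (ip (tapply S Y) Z) - ip (tapply S (D X Y)) Z - ip (tapply S Y) (D X Z)"
  using assms metric_compatible[of X "tapply S Y" Z] by (simp add: cov_deriv_def ip_lin tensor_VF)

lemma cov_deriv_lin_left:
  assumes "is_tensor11 \<A> S" "X \<in> VF" "Y \<in> VF"
  shows "X' \<in> VF \<Longrightarrow> cov_deriv D (X + X') S Y = cov_deriv D X S Y + cov_deriv D X' S Y"
    "X' \<in> VF \<Longrightarrow> cov_deriv D (X - X') S Y = cov_deriv D X S Y - cov_deriv D X' S Y"
    "cov_deriv D (- X) S Y = - cov_deriv D X S Y"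
    "f \<in> SF \<Longrightarrow> cov_deriv D (fmult f X) S Y = fmult f (cov_deriv D X S Y)"
  using assms
  by (simp_all add: cov_deriv_def D_add_left D_diff_left D_minus_left D_fmult_left tensor_lin tensor_VF)
    (rule ext, simp add: fmult_apply scaleR_diff_right)

lemma cov_deriv_lin_right:
  assumes "is_tensor11 \<A> S" "X \<in> VF" "Y \<in> VF"
  shows "cov_deriv D X S (- Y) = - cov_deriv D X S Y"
    "Y' \<in> VF \<Longrightarrow> cov_deriv D X S (Y + Y') = cov_deriv D X S Y + cov_deriv D X S Y'"
  using assms
  by (simp_all add: cov_deriv_def D_add_right D_minus_right tensor_lin tensor_VF)

lemma cov_deriv_skew:
  assumes S: "is_tensor11 \<A> S"
    and skew: "\<And>X Y. X \<in> VF \<Longrightarrow> Y \<in> VF \<Longrightarrow> ip (tapply S X) Y = - ip (tapply S Y) X"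
    and v: "X \<in> VF" "Y \<in> VF" "Z \<in> VF"
  shows "ip (cov_deriv D X S Y) Z = - ip (cov_deriv D X S Z) Y"
proof -
  have "ip (tapply S Y) Z = - ip (tapply S Z) Y" using skew v by blast
  then have "vderiv X (ip (tapply S Y) Z) = - vderiv X (ip (tapply S Z) Y)"
    using v S by (simp add: tensor_VF)
  moreover have "ip (tapply S (D X Y)) Z = - ip (tapply S Z) (D X Y)"
    "ip (tapply S Y) (D X Z) = - ip (tapply S (D X Z)) Y"
    by (rule skew; simp add: v)+
  ultimately show ?thesis using v S by (simp add: cov_deriv_form)
qed

section \<open>Exterior derivatives of 2-forms by the invariant bracket formula\<close>

definition ext2 :: "('a vfield \<Rightarrow> 'a vfield \<Rightarrow> 'a \<Rightarrow> real) \<Rightarrow> 'a vfield \<Rightarrow> 'a vfield \<Rightarrow> 'a vfield \<Rightarrow> 'a \<Rightarrow> real" where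
  "ext2 B X Y Z = vderiv X (B Y Z) + vderiv Y (B Z X) + vderiv Z (B X Y)
     - B (br X Y) Z - B (br Y Z) X - B (br Z X) Y"

lemma br_swap: "br X Y = - br Y X"
  by (simp add: lie_bracket_def fun_eq_iff)

lemma jacobi:
  assumes "X \<in> VF" "Y \<in> VF" "Z \<in> VF"
  shows "br (br X Y) Z + br (br Y Z) X + br (br Z X) Y = 0"
proof (intro ext)
  fix p f
  show "(br (br X Y) Z + br (br Y Z) X + br (br Z X) Y) p f = 0 p f"
  proof (cases "f \<in> SF")
    case True
    have e: "vderiv (br U V) f = vderiv U (vderiv V f) - vderiv V (vderiv U f)" for U V
      by (simp add: fun_eq_iff vderiv_def lie_bracket_def)
    have i: "br U V p f = U p (vderiv V f) - V p (vderiv U f)" for U V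
      by (simp add: lie_bracket_def)
    have d: "U p (vderiv V (vderiv W f) - vderiv W (vderiv V f)) = U p (vderiv V (vderiv W f)) - U p (vderiv W (vderiv V f))"
      if "U \<in> VF" "V \<in> VF" "W \<in> VF" for U V W
    proof -
      have "vderiv U (vderiv V (vderiv W f) - vderiv W (vderiv V f)) p
          = vderiv U (vderiv V (vderiv W f)) p - vderiv U (vderiv W (vderiv V f)) p"
        using that True by simp
      then show ?thesis by (simp only: vderiv_apply)
    qed
    have j: "br U V p (vderiv W f) = U p (vderiv V (vderiv W f)) - V p (vderiv U (vderiv W f))" for U V W
      by (simp add: lie_bracket_def)
    show ?thesis using assms by (simp add: i e d j)
  next
    case False
    then have "V p f = 0" if "V \<in> VF" for V using tangent_nonsmooth[OF atlas VF_TS] that by blast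
    from this[of "br (br X Y) Z"] this[of "br (br Y Z) X"] this[of "br (br Z X) Y"]
    show ?thesis using assms by simp
  qed
qed

text \<open>This is d d B = 0, with the outer derivative of a 3-form spelled out. Second derivatives
  cancel against derivatives along brackets, and the doubly nested brackets cancel by
  \<open>jacobi\<close> inside \<open>B\<close>.\<close>

lemma ext3_ext2:
  assumes B: "\<And>X Y. X \<in> VF \<Longrightarrow> Y \<in> VF \<Longrightarrow> B X Y \<in> SF"
    "\<And>X Y. X \<in> VF \<Longrightarrow> Y \<in> VF \<Longrightarrow> B X Y = - B Y X"
    "\<And>X Y Z. X \<in> VF \<Longrightarrow> Y \<in> VF \<Longrightarrow> Z \<in> VF \<Longrightarrow> B (X + Y) Z = B X Z + B Y Z"
    and v: "W \<in> VF" "X \<in> VF" "Y \<in> VF" "Z \<in> VF"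
  shows "vderiv W (ext2 B X Y Z) - vderiv X (ext2 B W Y Z) + vderiv Y (ext2 B W X Z) - vderiv Z (ext2 B W X Y)
    - ext2 B (br W X) Y Z + ext2 B (br W Y) X Z - ext2 B (br W Z) X Y
    - ext2 B (br X Y) W Z + ext2 B (br X Z) W Y - ext2 B (br Y Z) W X = 0"
proof -
  have B0: "B 0 U = 0" if "U \<in> VF" for U using B(3)[of 0 0 U] that by simp
  have Bm: "B (- U) V = - B U V" if "U \<in> VF" "V \<in> VF" for U V
    using B(3)[of U "- U" V] B0 that by (simp add: eq_neg_iff_add_eq_0 add.commute)
  have J: "B (br (br U V) V') V'' + B (br (br V V') U) V'' + B (br (br V' U) V) V'' = 0"
    if "U \<in> VF" "V \<in> VF" "V' \<in> VF" "V'' \<in> VF" for U V V' V''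
    using B(3)[of "br (br U V) V' + br (br V V') U" "br (br V' U) V" V'']
      B(3)[of "br (br U V) V'" "br (br V V') U" V''] jacobi[of U V V'] B0 that by simp
  have d: "vderiv (br U V) f = vderiv U (vderiv V f) - vderiv V (vderiv U f)" for U V f
    by (simp add: fun_eq_iff vderiv_def lie_bracket_def)
  \<comment> \<open>Skew-symmetry enters through instances that impose one order (W, X, Y, Z, with
    brackets first), so that equal terms become literally equal up to sign.\<close>
  have sw: "B Z X = - B X Z" "B Z W = - B W Z" "B Y W = - B W Y"
    "br Z X = - br X Z" "br Z W = - br W Z" "br Y W = - br W Y"
    by (rule B(2) br_swap; simp add: v)+
  have sw2: "B X (br V V') = - B (br V V') X" "B Y (br V V') = - B (br V V') Y"
    "B Z (br V V') = - B (br V V') Z" "B W (br V V') = - B (br V V') W"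
    if "V \<in> VF" "V' \<in> VF" for V V'
    by (rule B(2); simp add: that v)+
  have sw3: "B (br Y Z) (br W X) = - B (br W X) (br Y Z)" "B (br X Z) (br W Y) = - B (br W Y) (br X Z)"
    "B (br X Y) (br W Z) = - B (br W Z) (br X Y)"
    by (rule B(2); simp add: v)+
  have sw4: "br X (br V V') = - br (br V V') X" "br Y (br V V') = - br (br V V') Y"
    "br Z (br V V') = - br (br V V') Z" "br W (br V V') = - br (br V V') W" for V V'
    by (rule br_swap)+
  have brm: "br (- U) V = - br U V" if "U \<in> VF" "V \<in> VF" for U V
    using that by (simp add: torsion_free D_minus_left D_minus_right)
  note JJ = J[of W X Y Z] J[of W X Z Y] J[of W Y Z X] J[of X Y Z W]
  show ?thesis
  proof
    fix p
    show "(vderiv W (ext2 B X Y Z) - vderiv X (ext2 B W Y Z) + vderiv Y (ext2 B W X Z) - vderiv Z (ext2 B W X Y)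
      - ext2 B (br W X) Y Z + ext2 B (br W Y) X Z - ext2 B (br W Z) X Y
      - ext2 B (br X Y) W Z + ext2 B (br X Z) W Y - ext2 B (br Y Z) W X) p = 0 p"
      using JJ[THEN fun_cong, of p] v
      by (simp add: ext2_def d B(1) sw sw2 sw3 sw4 brm Bm)
  qed
qed

text \<open>Since the connection is metric and torsion-free, the bracket terms of the exterior
  derivative cancel the connection terms of the covariant derivatives.\<close>

lemma ext2_skew_tensor:
  assumes S: "is_tensor11 \<A> S"
    and skew: "\<And>X Y. X \<in> VF \<Longrightarrow> Y \<in> VF \<Longrightarrow> ip (tapply S X) Y = - ip (tapply S Y) X"
    and v: "X \<in> VF" "Y \<in> VF" "Z \<in> VF"
  shows "ext2 (\<lambda>X Y. ip (tapply S X) Y) X Y Z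
    = ip (cov_deriv D X S Y) Z + ip (cov_deriv D Y S Z) X + ip (cov_deriv D Z S X) Y"
proof -
  have "ip (tapply S Y) (D X Z) = - ip (tapply S (D X Z)) Y"
    "ip (tapply S Z) (D Y X) = - ip (tapply S (D Y X)) Z"
    "ip (tapply S X) (D Z Y) = - ip (tapply S (D Z Y)) X"
    by (rule skew; simp add: v)+
  then show ?thesis
    using v S by (simp add: ext2_def cov_deriv_form torsion_free tensor_lin tensor_VF ip_lin)
qed

text \<open>The inner bilinear expression is the exterior derivative of the 1-form dual to
  \<open>U\<close>, so this is d d = 0 on 1-forms; it serves with \<xi> for
  \<open>U\<close>.\<close>

lemma ext2_ext1:
  assumes v: "U \<in> VF" "X \<in> VF" "Y \<in> VF" "Z \<in> VF"
  shows "ext2 (\<lambda>X Y. vderiv X (ip Y U) - vderiv Y (ip X U) - ip (br X Y) U) X Y Z = 0"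
proof -
  have d: "vderiv (br V W) f = vderiv V (vderiv W f) - vderiv W (vderiv V f)" for V W f
    by (simp add: fun_eq_iff vderiv_def lie_bracket_def)
  have "ip (br (br X Y) Z) U + ip (br (br Y Z) X) U + ip (br (br Z X) Y) U = 0"
  proof -
    have "ip (br (br X Y) Z + br (br Y Z) X + br (br Z X) Y) U = 0"
      using jacobi[OF v(2-4)] v by (simp add: ip_lin)
    then show ?thesis using v by (subst (asm) ip_lin; simp)+
  qed
  then show ?thesis
    using v by (simp add: ext2_def d ip_lin algebra_simps)
qed

end

section \<open>Reduction to the nearly cosymplectic case\<close>

locale weak_nearly_cosymplectic_manifold =
  fixes \<A> :: "('a::{t2_space, second_countable_topology}, 'e::euclidean_space) chart set"
    and \<phi> Q h :: "'a tensor11" and \<xi> :: "'a vfield" and \<eta> :: "'a one_form"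
    and g :: "'a tensor02" and D :: "'a conn"
  assumes atlas': "smooth_atlas \<A>"
    and wnc: "weak_nearly_cosymplectic \<A> \<phi> Q \<xi> \<eta> g D"
    and h_tensor: "is_tensor11 \<A> h"
    and h_nabla: "\<And>X. X \<in> vector_fields \<A> \<Longrightarrow> tapply h X = D X \<xi>"

sublocale weak_nearly_cosymplectic_manifold \<subseteq> riemannian_manifold \<A> g D
  using atlas' wnc
  by unfold_locales (simp_all add: weak_nearly_cosymplectic_def weak_almost_contact_metric_def)

context weak_nearly_cosymplectic_manifold
begin

abbreviation P :: "'a vfield \<Rightarrow> 'a vfield" where "P \<equiv> tapply \<phi>"
abbreviation H :: "'a vfield \<Rightarrow> 'a vfield" where "H \<equiv> tapply h"

lemma minus_add_eq_0_iff: "- a + b = 0 \<longleftrightarrow> a = b" for a b :: "'b::group_add"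
  using neg_eq_iff_add_eq_0[of "- a" b] by simp

lemma wac: "weak_almost_contact \<A> \<phi> Q \<xi> \<eta>"
  using wnc by (simp add: weak_nearly_cosymplectic_def weak_almost_contact_metric_def)

lemma phi_tensor: "is_tensor11 \<A> \<phi>" and Q_tensor: "is_tensor11 \<A> Q"
  and xi_VF [simp]: "\<xi> \<in> VF" and eta_form: "is_one_form \<A> \<eta>" and Q_nonsingular: "nonsingular \<A> Q"
  using wac by (simp_all add: weak_almost_contact_def)

lemma phi_phi: "v \<in> TS p \<Longrightarrow> \<phi> p (\<phi> p v) = - Q p v + \<eta> p v *\<^sub>R \<xi> p"
  and eta_xi: "\<eta> p (\<xi> p) = 1" and Q_xi: "Q p (\<xi> p) = \<xi> p"
  and eta_phi_ker: "v \<in> TS p \<Longrightarrow> \<eta> p v = 0 \<Longrightarrow> \<eta> p (\<phi> p v) = 0"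
  using wac by (simp_all add: weak_almost_contact_def)

lemmas phi_at = tensor_at[OF phi_tensor]
lemmas Q_at = tensor_at[OF Q_tensor]
lemmas h_at = tensor_at[OF h_tensor]
lemmas P_lin = tensor_lin[OF phi_tensor] tensor_zero[OF phi_tensor]
lemmas H_lin = tensor_lin[OF h_tensor] tensor_zero[OF h_tensor]

lemma zero_at [simp]: "\<phi> p 0 = 0" "Q p 0 = 0" "h p 0 = 0"
  using phi_at(6)[OF TS_simps(3)] Q_at(6)[OF TS_simps(3)] h_at(6)[OF TS_simps(3)] by blast+

lemma in_TS [simp]:
  "v \<in> TS p \<Longrightarrow> \<phi> p v \<in> TS p" "v \<in> TS p \<Longrightarrow> Q p v \<in> TS p" "v \<in> TS p \<Longrightarrow> h p v \<in> TS p"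
  by (rule phi_at Q_at h_at, assumption)+

lemma in_VF [simp]:
  "X \<in> VF \<Longrightarrow> P X \<in> VF" "X \<in> VF \<Longrightarrow> tapply Q X \<in> VF" "X \<in> VF \<Longrightarrow> H X \<in> VF"
  by (simp_all add: tensor_VF phi_tensor Q_tensor h_tensor)

lemma Q_inj: "inj_on (Q p) (TS p)"
  using Q_nonsingular by (simp add: nonsingular_def bij_betw_def)

lemma compat:
  assumes "u \<in> TS p" "v \<in> TS p"
  shows "g p (\<phi> p u) (\<phi> p v) = g p u (Q p v) - \<eta> p u * \<eta> p v"
proof -
  obtain X Y where XY: "X \<in> VF" "Y \<in> VF" "X p = u" "Y p = v"
    using VF_ext assms by meson
  have "ip (P X) (P Y) = ip X (tapply Q Y) - tapply \<eta> X * tapply \<eta> Y"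
    using wnc XY by (simp add: weak_nearly_cosymplectic_def weak_almost_contact_metric_def)
  from fun_cong[OF this, of p] show ?thesis
    using XY by (simp add: tapply2_apply tapply_apply)
qed

text \<open>Since \<open>Q\<close> fixes \<xi>, the square of \<phi> kills \<xi>. Applying the
  formula for that square to \<phi> \<xi> then shows, by injectivity of \<open>Q\<close>, that
  \<phi> \<xi> is a multiple of \<xi>; a further application of \<phi> forces the multiple to be
  0.\<close>

lemma phi_xi: "\<phi> p (\<xi> p) = 0"
proof -
  let ?x = "\<xi> p" and ?u = "\<phi> p (\<xi> p)"
  have x: "?x \<in> TS p" by simp
  have phi_u: "\<phi> p ?u = 0" using phi_phi[OF x] by (simp add: Q_xi eta_xi)
  then have "0 = - Q p ?u + \<eta> p ?u *\<^sub>R ?x" using phi_phi[OF in_TS(1)[OF x]] by (simp only: zero_at)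
  from this[symmetric] have "Q p ?u = \<eta> p ?u *\<^sub>R ?x" by (simp only: minus_add_eq_0_iff)
  also have "\<dots> = Q p (\<eta> p ?u *\<^sub>R ?x)" using Q_at(3)[OF x] by (simp only: Q_xi)
  finally have "Q p ?u = Q p (\<eta> p ?u *\<^sub>R ?x)" .
  from inj_onD[OF Q_inj, OF this] x have u: "?u = \<eta> p ?u *\<^sub>R ?x" by (simp only: in_TS TS_simps)
  from arg_cong[OF this, of "\<phi> p"] have "\<eta> p ?u *\<^sub>R ?u = 0" by (simp only: phi_at(3)[OF x] phi_u)
  then have "\<eta> p ?u = 0 \<or> ?u = 0" by (simp only: scaleR_eq_0_iff)
  then show ?thesis
  proof
    assume "\<eta> p ?u = 0"
    with u show ?thesis by (simp only: scaleR_zero_left)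
  qed
qed

lemma eta_g: "v \<in> TS p \<Longrightarrow> \<eta> p v = g p v (\<xi> p)"
  using compat[of v p "\<xi> p"] by (simp add: phi_xi Q_xi eta_xi g_lin)

lemma eta_phi: "v \<in> TS p \<Longrightarrow> \<eta> p (\<phi> p v) = 0"
  using eta_phi_ker[of "v - \<eta> p v *\<^sub>R \<xi> p" p] eta_xi[of p]
  by (simp add: phi_at phi_xi eta_g g_lin)

lemma g_phi_xi: "v \<in> TS p \<Longrightarrow> g p (\<phi> p v) (\<xi> p) = 0"
  using eta_phi[of v p] by (simp add: eta_g)

lemma Q_sym:
  assumes "u \<in> TS p" "v \<in> TS p"
  shows "g p u (Q p v) = g p (Q p u) v"
  using compat[OF assms] compat[OF assms(2,1)] assms g_sym[of "\<phi> p u" p "\<phi> p v"] g_sym[of "Q p u" p v]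
  by simp

lemma phi_Q:
  assumes "v \<in> TS p" shows "\<phi> p (Q p v) = Q p (\<phi> p v)"
proof -
  have "- Q p (\<phi> p v) = \<phi> p (\<phi> p (\<phi> p v))" using assms phi_phi[of "\<phi> p v" p] by (simp add: eta_phi)
  also have "\<dots> = - \<phi> p (Q p v)" using assms by (simp add: phi_phi phi_at phi_xi)
  finally show ?thesis by simp
qed

text \<open>\<open>compat\<close> only controls \<phi> against \<phi>. Surjectivity of
  \<open>Q\<close> allows \<open>w = Q v\<close>, and \<open>Q v\<close> is minus the square of
  \<phi> on \<open>v\<close> up to a multiple of \<xi>, which is orthogonal to the image of
  \<phi>.\<close>

lemma phi_skew_at:
  assumes u: "u \<in> TS p" and w: "w \<in> TS p"
  shows "g p (\<phi> p u) w = - g p (\<phi> p w) u"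
proof -
  have "Q p ` TS p = TS p" using Q_nonsingular by (simp add: nonsingular_def bij_betw_def)
  then obtain v where v: "v \<in> TS p" "w = Q p v" using w by blast
  have "g p (\<phi> p u) (- Q p v + \<eta> p v *\<^sub>R \<xi> p) = g p u (Q p (\<phi> p v)) - \<eta> p u * \<eta> p (\<phi> p v)"
    using compat[of u p "\<phi> p v"] u v by (simp add: phi_phi)
  then show ?thesis using u v g_sym[of u p "Q p (\<phi> p v)"] by (simp add: g_lin g_phi_xi eta_phi phi_Q)
qed

lemma phi_skew:
  assumes "X \<in> VF" "Y \<in> VF"
  shows "ip (P X) Y = - ip (P Y) X"
proof
  fix p show "ip (P X) Y p = (- ip (P Y) X) p"
    using phi_skew_at[of "X p" p "Y p"] assms by (simp add: tapply2_apply tapply_apply)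
qed

lemma P_xi: "P \<xi> = 0"
  by (rule ext) (simp add: tapply_apply phi_xi)

lemma ip_P_xi [simp]: "X \<in> VF \<Longrightarrow> ip (P X) \<xi> = 0"
  by (rule ext) (simp add: tapply2_apply tapply_apply g_phi_xi)

lemma ip_xi_xi: "ip \<xi> \<xi> = 1"
  by (rule ext) (use eta_xi eta_g in \<open>simp add: tapply2_apply\<close>)

lemma ip_H_xi [simp]: "X \<in> VF \<Longrightarrow> ip (H X) \<xi> = 0"
proof
  fix p assume X: "X \<in> VF"
  have "vderiv X (ip \<xi> \<xi>) p = ip (D X \<xi>) \<xi> p + ip \<xi> (D X \<xi>) p"
    using metric_compatible[of X \<xi> \<xi>] X by simp
  then show "ip (H X) \<xi> p = 0 p"
    using X ip_sym[of \<xi> "D X \<xi>"] by (simp add: ip_xi_xi h_nabla)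
qed

section \<open>The covariant derivative of \<phi> as a totally skew tensor\<close>

abbreviation T :: "'a vfield \<Rightarrow> 'a vfield \<Rightarrow> 'a vfield \<Rightarrow> 'a \<Rightarrow> real" where
  "T X Y Z \<equiv> ip (cov_deriv D X \<phi> Y) Z"

lemma cov_phi_VF [simp]: "X \<in> VF \<Longrightarrow> Y \<in> VF \<Longrightarrow> cov_deriv D X \<phi> Y \<in> VF"
  by (simp add: phi_tensor)

lemma cov_phi_swap: "X \<in> VF \<Longrightarrow> Y \<in> VF \<Longrightarrow> cov_deriv D X \<phi> Y = - cov_deriv D Y \<phi> X"
  using wnc by (simp add: weak_nearly_cosymplectic_def eq_neg_iff_add_eq_0)

lemma T_skew12: "X \<in> VF \<Longrightarrow> Y \<in> VF \<Longrightarrow> Z \<in> VF \<Longrightarrow> T X Y Z = - T Y X Z"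
  using cov_phi_swap[of X Y] by (simp add: ip_lin)

lemma T_skew23: "X \<in> VF \<Longrightarrow> Y \<in> VF \<Longrightarrow> Z \<in> VF \<Longrightarrow> T X Y Z = - T X Z Y"
  by (rule cov_deriv_skew[OF phi_tensor phi_skew])

lemma T_cyc: "X \<in> VF \<Longrightarrow> Y \<in> VF \<Longrightarrow> Z \<in> VF \<Longrightarrow> T X Y Z = T Y Z X"
  by (simp only: T_skew12[of X Y Z] T_skew23[of Y X Z] minus_minus)

lemma cov_phi_xi: "X \<in> VF \<Longrightarrow> cov_deriv D X \<phi> \<xi> = - P (H X)"
  by (simp add: cov_deriv_def P_xi D_zero_right h_nabla)

lemma cov_xi_phi: "X \<in> VF \<Longrightarrow> cov_deriv D \<xi> \<phi> X = P (H X)"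
  using cov_phi_swap[of \<xi> X] cov_phi_xi[of X] by simp

lemma eta_h:
  assumes "v \<in> TS p" shows "\<eta> p (h p v) = 0"
proof -
  obtain X where X: "X \<in> VF" "X p = v" using VF_ext assms by blast
  from fun_cong[OF ip_H_xi[OF X(1)], of p] have "g p (h p v) (\<xi> p) = 0"
    by (simp only: tapply2_apply tapply_apply X(2) zero_fun_apply)
  then show ?thesis using assms by (simp add: eta_g)
qed

lemma g_h_xi: "v \<in> TS p \<Longrightarrow> g p (h p v) (\<xi> p) = 0"
  using eta_h[of v p] by (simp add: eta_g)

text \<open>At \<xi> the formulas \<open>cov_phi_xi\<close> and \<open>cov_xi_phi\<close> give
  opposite values for the same vector, so \<phi> h \<xi> = 0; injectivity of \<open>Q\<close>
  removes the \<phi>.\<close>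

lemma h_xi: "h p (\<xi> p) = 0"
proof -
  have "P (H \<xi>) = - P (H \<xi>)" using cov_phi_xi[OF xi_VF] cov_xi_phi[OF xi_VF] by (rule trans[OF sym, rotated])
  from fun_cong[OF this, of p] have "\<phi> p (h p (\<xi> p)) + \<phi> p (h p (\<xi> p)) = 0"
    by (simp only: tapply_apply fun_Compl_def[of "P (H \<xi>)"] eq_neg_iff_add_eq_0)
  then have "2 *\<^sub>R \<phi> p (h p (\<xi> p)) = 0" by (simp only: scaleR_2)
  then have "\<phi> p (h p (\<xi> p)) = 0" by simp
  then have "0 = - Q p (h p (\<xi> p)) + \<eta> p (h p (\<xi> p)) *\<^sub>R \<xi> p"
    using phi_phi[of "h p (\<xi> p)" p] by (simp only: zero_at in_TS VF_TS xi_VF)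
  moreover have "\<eta> p (h p (\<xi> p)) = 0" by (rule eta_h) simp
  ultimately have "Q p (h p (\<xi> p)) = Q p 0" by simp
  from inj_onD[OF Q_inj, OF this] show ?thesis by simp
qed

lemma H_xi: "H \<xi> = 0"
  by (rule ext) (simp add: tapply_apply h_xi)

text \<open>The map \<open>?F\<close> is injective: \<eta> of its value is \<eta> of the argument,
  so a kernel vector lies in ker \<eta> and in the kernel of h, hence in the line of \<xi>, and is
  0. Transported to \<open>'e\<close> by \<open>L\<close> it is onto, and \<eta> shows that the
  preimage of a vector in ker \<eta> is again in ker \<eta>.\<close>

lemma h_onto_ker_eta:
  assumes simple: "simple_eigenvalue_on (TS p) (\<lambda>v. h p (h p v)) 0"
    and w: "w \<in> TS p" "\<eta> p w = 0"
  shows "\<exists>v\<in>TS p. \<eta> p v = 0 \<and> h p v = w"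
proof -
  let ?K = "{v \<in> TS p. h p (h p v) = 0 *\<^sub>R v}"
  let ?F = "\<lambda>v. h p v + \<eta> p v *\<^sub>R \<xi> p"
  have xi0: "\<xi> p \<noteq> 0" using eta_xi[of p] eta_g[of "\<xi> p" p] by (auto simp: g_lin)
  have K: "\<xi> p \<in> ?K" by (simp add: h_xi h_at)
  have K_span: "v \<in> span {\<xi> p}" if "v \<in> ?K" for v
  proof (rule ccontr)
    assume "v \<notin> span {\<xi> p}"
    then have ind: "independent {v, \<xi> p}" and "v \<noteq> \<xi> p"
      using xi0 by (auto simp: independent_insert span_base)
    have d1: "dim ?K = 1" using simple by (simp add: simple_eigenvalue_on_def)
    obtain B where B: "B \<subseteq> ?K" "independent B" "?K \<subseteq> span B" "card B = dim ?K"
      by (rule basis_exists)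
    \<comment> \<open>An infinite set has \<open>card\<close> 0, so dimension 1 excludes an infinite
      basis.\<close>
    have "finite B" using B(4) d1 card.infinite by fastforce
    then have "card {v, \<xi> p} \<le> card B"
      using independent_span_bound[OF _ ind] B(3) that K by blast
    then show False using B(4) d1 \<open>v \<noteq> \<xi> p\<close> by simp
  qed
  obtain L :: "'e \<Rightarrow> 'a tvec" where L: "linear L" "inj L" "range L = TS p"
    using tangent_space_coords[OF atlas] by blast
  define G where "G x = inv L (?F (L x))" for x
  have LT: "L x \<in> TS p" for x using L(3) by blast
  have FT: "?F v \<in> TS p" if "v \<in> TS p" for v using that by simp
  have LG: "L (G x) = ?F (L x)" for x
    unfolding G_def using FT[OF LT] L(3) by (simp add: f_inv_into_f)
  have "linear G"
  proof (rule linearI)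
    show "G (x + y) = G x + G y" for x y
      by (rule injD[OF L(2)]) (simp add: LG linear_add[OF L(1)] h_at LT eta_g g_lin algebra_simps)
    show "G (c *\<^sub>R x) = c *\<^sub>R G x" for c x
      by (rule injD[OF L(2)]) (simp add: LG linear_scale[OF L(1)] h_at LT eta_g g_lin algebra_simps)
  qed
  moreover have "x = 0" if "G x = 0" for x
  proof -
    have F0: "?F (L x) = 0" using LG[of x] that linear_0[OF L(1)] by simp
    have "\<eta> p (?F (L x)) = \<eta> p (L x)"
      using eta_xi[of p] LT[of x] by (simp add: eta_g g_lin g_h_xi)
    then have e0: "\<eta> p (L x) = 0" using F0 by (simp add: eta_g g_lin)
    with F0 have "h p (L x) = 0" by simp
    then have "L x \<in> ?K" using LT by (simp add: h_at)
    then obtain c where c: "L x = c *\<^sub>R \<xi> p" using K_span by (auto simp: span_singleton)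
    with e0 eta_xi[of p] have "c = 0" by (simp add: eta_g g_lin)
    with c have "L x = L 0" using linear_0[OF L(1)] by simp
    then show "x = 0" by (rule injD[OF L(2)])
  qed
  ultimately have "surj G"
    using linear_injective_imp_surjective linear_injective_0 by blast
  then obtain x where "G x = inv L w" by (metis surjD)
  then have Fw: "?F (L x) = w" using LG[of x] w(1) L(3) by (simp add: f_inv_into_f)
  have "\<eta> p (?F (L x)) = \<eta> p (L x)"
    using eta_xi[of p] LT[of x] by (simp add: eta_g g_lin g_h_xi)
  with Fw w(2) have "\<eta> p (L x) = 0" by simp
  with Fw LT show ?thesis by auto
qed

text \<open>Condition (A) makes \<open>(D\<^sub>X Q) \<xi>\<close> orthogonal to \<open>ker \<eta>\<close>, so the image of \<open>h\<close> consists of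
  fixed vectors of \<open>Q\<close>; under the eigenvalue assumption that image is all of \<open>ker \<eta>\<close>.\<close>

lemma Q_id:
  assumes A: "\<forall>X\<in>VF. \<forall>Y\<in>ker_fields \<A> \<eta>. cov_deriv D X Q Y = 0"
    and simple: "\<forall>p. simple_eigenvalue_on (TS p) (\<lambda>v. h p (h p v)) 0"
    and v: "v \<in> TS p"
  shows "Q p v = v"
proof -
  have ker: "Q p u = u" if u: "u \<in> TS p" "\<eta> p u = 0" for u
  proof -
    obtain Y0 where Y0: "Y0 \<in> VF" "Y0 p = u" using VF_ext u by blast
    \<comment> \<open>Condition (A) concerns fields that lie in ker \<eta> everywhere. Removing the
      \<xi>-component achieves this and does not change the value \<open>u\<close> at
      \<open>p\<close>.\<close>
    define Y where "Y = Y0 - fmult (ip Y0 \<xi>) \<xi>"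
    have Y: "Y \<in> VF" by (simp add: Y_def Y0)
    have Yx: "ip Y \<xi> = 0" by (simp add: Y_def Y0 ip_lin ip_fmult ip_xi_xi)
    have Yp: "Y p = u" using u Y0 by (simp add: Y_def fmult_apply eta_g tapply2_apply)
    have Yk: "Y \<in> ker_fields \<A> \<eta>"
      using Y fun_cong[OF Yx] by (auto simp: ker_fields_def tapply_def eta_g tapply2_apply)
    have QYx: "ip (tapply Q Y) \<xi> = 0"
    proof
      fix q show "ip (tapply Q Y) \<xi> q = 0 q"
        using Y fun_cong[OF Yx, of q] Q_sym[of "Y q" q "\<xi> q"] by (simp add: tapply2_apply tapply_apply Q_xi)
    qed
    \<comment> \<open>Differentiate g(Q Y, \<xi>) = 0 and g(Y, \<xi>) = 0 along \<open>X\<close>. By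
      (A) the derivative passes through \<open>Q\<close>, and Q \<xi> = \<xi> makes the first terms
      agree, leaving the equality of the terms with h X.\<close>
    have orth: "ip (tapply Q Y) (H X) = ip Y (H X)" if X: "X \<in> VF" for X
    proof -
      have "D X (tapply Q Y) = tapply Q (D X Y)" using A X Yk by (simp add: cov_deriv_def)
      then have 1: "vderiv X (ip (tapply Q Y) \<xi>) = ip (tapply Q (D X Y)) \<xi> + ip (tapply Q Y) (H X)"
        using metric_compatible[of X "tapply Q Y" \<xi>] X Y by (simp add: h_nabla)
      have 2: "vderiv X (ip Y \<xi>) = ip (D X Y) \<xi> + ip Y (H X)"
        using metric_compatible[of X Y \<xi>] X Y by (simp add: h_nabla)
      have 3: "ip (tapply Q (D X Y)) \<xi> = ip (D X Y) \<xi>"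
      proof
        fix q show "ip (tapply Q (D X Y)) \<xi> q = ip (D X Y) \<xi> q"
          using X Y Q_sym[of "D X Y q" q "\<xi> q"] by (simp add: tapply2_apply tapply_apply Q_xi)
      qed
      have "ip (D X Y) \<xi> + ip (tapply Q Y) (H X) = ip (D X Y) \<xi> + ip Y (H X)"
        using 1 2 3 Yx QYx X by simp
      then show ?thesis by simp
    qed
    \<comment> \<open>By surjectivity this difference is itself a value of h, so \<open>orth\<close>
      tests it against itself.\<close>
    let ?w = "Q p u - u"
    have e: "\<eta> p ?w = 0"
      using u fun_cong[OF QYx, of p] Yp by (simp add: eta_g g_lin tapply2_apply tapply_apply)
    then obtain x where x: "x \<in> TS p" "h p x = ?w" using h_onto_ker_eta[of p ?w] simple u by auto
    obtain X where X: "X \<in> VF" "X p = x" using VF_ext x by blast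
    have "g p ?w ?w = 0"
      using fun_cong[OF orth[OF X(1)], of p] u x X Yp by (simp add: tapply2_apply tapply_apply g_lin)
    then show ?thesis using g_pos[of ?w p] u by auto
  qed
  have "Q p (v - \<eta> p v *\<^sub>R \<xi> p) = v - \<eta> p v *\<^sub>R \<xi> p"
    using ker[of "v - \<eta> p v *\<^sub>R \<xi> p"] v eta_xi[of p] by (simp add: eta_g g_lin)
  then show ?thesis using v by (simp add: Q_at Q_xi)
qed

end

section \<open>Nearly cosymplectic manifolds\<close>

locale nearly_cosymplectic_manifold = weak_nearly_cosymplectic_manifold \<A> \<phi> Q h \<xi> \<eta> g D
  for \<A> :: "('a::{t2_space, second_countable_topology}, 'e::euclidean_space) chart set"
    and \<phi> Q h :: "'a tensor11" and \<xi> :: "'a vfield" and \<eta> :: "'a one_form"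
    and g :: "'a tensor02" and D :: "'a conn" +
  assumes Q_identity: "v \<in> tangent_space \<A> p \<Longrightarrow> Q p v = v"
begin

lemma fmult_zero [simp]: "fmult 0 X = 0" "fmult f 0 = 0"
  by (rule ext; simp add: fmult_apply)+

lemma vderiv_2_3 [simp]:
  assumes "X \<in> VF" "f \<in> SF"
  shows "vderiv X (2 * f) = 2 * vderiv X f" "vderiv X (3 * f) = 3 * vderiv X f"
proof -
  have 3: "3 * u = u + u + u" for u :: "'a \<Rightarrow> real" by (simp add: algebra_simps)
  have "f + f \<in> SF" using assms(2,2) by (rule SF_simps(1))
  then show "vderiv X (2 * f) = 2 * vderiv X f" "vderiv X (3 * f) = 3 * vderiv X f"
    unfolding mult_2 3 using assms by (simp_all only: vderiv_add)
qed

lemma P_P: "X \<in> VF \<Longrightarrow> P (P X) = - X + fmult (ip X \<xi>) \<xi>"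
  by (rule ext) (simp add: tapply_apply fmult_apply tapply2_apply phi_phi Q_identity eta_g)

lemma ip_xi_H [simp]: "X \<in> VF \<Longrightarrow> ip \<xi> (H X) = 0"
  using ip_H_xi[of X] ip_sym[of \<xi> "H X"] by simp

lemma ip_PP: "X \<in> VF \<Longrightarrow> Y \<in> VF \<Longrightarrow> ip (P X) (P Y) = ip X Y - ip X \<xi> * ip Y \<xi>"
  using phi_skew[of X "P Y"] ip_sym[of \<xi> X] ip_sym[of Y X] by (simp add: P_P ip_lin ip_fmult algebra_simps)

text \<open>Covariant derivative of the identity \<open>P_P\<close>; the skewness of \<phi> moves
  the outer \<phi> onto \<open>Z\<close>.\<close>

lemma T_phi_phi:
  assumes v: "X \<in> VF" "Y \<in> VF" "Z \<in> VF"
  shows "T X (P Y) Z - T X Y (P Z) = ip (H X) Y * ip Z \<xi> + ip Y \<xi> * ip (H X) Z"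
proof -
  have 1: "ip (P (D X (P Y))) Z = - ip (D X (P Y)) (P Z)"
    using phi_skew[of "D X (P Y)" Z] ip_sym[of "P Z" "D X (P Y)"] v by simp
  have 2: "D X (P (P Y)) = - D X Y + (fmult (vderiv X (ip Y \<xi>)) \<xi> + fmult (ip Y \<xi>) (H X))"
    using v by (simp add: P_P D_add_right D_diff_right D_minus_right D_fmult_right h_nabla)
  have 3: "vderiv X (ip Y \<xi>) = ip (D X Y) \<xi> + ip (H X) Y"
    using v metric_compatible[of X Y \<xi>] ip_sym[of Y "H X"] by (simp add: h_nabla)
  show ?thesis
    using v ip_sym[of \<xi> Z]
    by (simp add: cov_deriv_def ip_lin ip_fmult 1 2 3 ip_PP algebra_simps)
qed

text \<open>The case X = \<xi> of \<open>T_phi_phi\<close>, where the right-hand side vanishes by h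
  \<xi> = 0 and the derivative of \<phi> along \<xi> is \<phi> h.\<close>

lemma P_H_P: assumes "Y \<in> VF" shows "P (H (P Y)) = H Y"
proof (rule VF_eqI)
  fix Z p assume Z: "Z \<in> VF"
  have "T \<xi> (P Y) Z = T \<xi> Y (P Z)"
    using T_phi_phi[of \<xi> Y Z] assms Z by (simp add: H_xi ip_lin)
  then have "ip (P (H (P Y))) Z = ip (P (H Y)) (P Z)"
    using assms by (simp add: cov_xi_phi)
  also have "\<dots> = ip (H Y) Z" using assms Z by (simp add: ip_PP)
  finally show "ip (P (H (P Y))) Z p = ip (H Y) Z p" by simp
qed (use assms in simp_all)

lemma P_H: assumes "Y \<in> VF" shows "P (H Y) = - H (P Y)"
proof -
  have "P (P (H (P Y))) = P (H Y)" using P_H_P[OF assms] by simp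
  then show ?thesis using assms by (simp add: P_P)
qed

lemma PH_skew: "X \<in> VF \<Longrightarrow> Y \<in> VF \<Longrightarrow> ip (P (H X)) Y = - ip (P (H Y)) X"
  using T_skew23[of \<xi> X Y] by (simp add: cov_xi_phi)

text \<open>That is, \<xi> is Killing. Skewness of \<phi> and of \<phi> h, with \<phi> h = - h
  \<phi>, gives the claim for arguments in the image of \<phi>. Every field is in that image up to a
  multiple of \<xi>, which h kills and to which the image of h is orthogonal.\<close>

lemma H_skew:
  assumes v: "Y \<in> VF" "Z \<in> VF" shows "ip (H Y) Z = - ip (H Z) Y"
proof -
  have *: "ip (H (P U)) Z = - ip (P U) (H Z)" if "U \<in> VF" for U
  proof -
    have "- ip (H (P U)) Z = ip (P U) (H Z)"
      using PH_skew[of U Z] phi_skew[of "H Z" U] P_H[of U] that v by (simp add: ip_lin)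
    then show ?thesis by (metis minus_minus)
  qed
  have "H (P (P Y)) = - H Y"
    using v by (simp add: P_P H_lin H_xi)
  then have "ip (H Y) Z = ip (P (P Y)) (H Z)"
    using *[of "P Y"] v by (simp add: ip_lin)
  also have "\<dots> = - ip (H Z) Y"
    using v ip_sym[of Y "H Z"] by (simp add: P_P ip_lin ip_fmult)
  finally show ?thesis .
qed

section \<open>The covariant derivative of h and the closedness of T\<close>

abbreviation K :: "'a vfield \<Rightarrow> 'a vfield \<Rightarrow> 'a vfield \<Rightarrow> 'a \<Rightarrow> real" where
  "K X Y Z \<equiv> ip (cov_deriv D X h Y) Z"

lemma cov_h_VF [simp]: "X \<in> VF \<Longrightarrow> Y \<in> VF \<Longrightarrow> cov_deriv D X h Y \<in> VF"
  by (simp add: h_tensor)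

lemma K_skew23: "X \<in> VF \<Longrightarrow> Y \<in> VF \<Longrightarrow> Z \<in> VF \<Longrightarrow> K X Y Z = - K X Z Y"
  by (rule cov_deriv_skew[OF h_tensor H_skew])

text \<open>By \<open>H_skew\<close> the exterior derivative of \<eta> is 2 g(h X, Y), so half of d
  d \<eta> = 0 is the cyclic sum given by \<open>ext2_skew_tensor\<close>.\<close>

lemma K_cyc:
  assumes v: "X \<in> VF" "Y \<in> VF" "Z \<in> VF"
  shows "K X Y Z p + K Y Z X p + K Z X Y p = 0"
proof -
  let ?B = "\<lambda>X Y. vderiv X (ip Y \<xi>) - vderiv Y (ip X \<xi>) - ip (br X Y) \<xi>"
  have B: "?B X Y = ip (H X) Y + ip (H X) Y" if "X \<in> VF" "Y \<in> VF" for X Y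
    using that metric_compatible[of X Y \<xi>] metric_compatible[of Y X \<xi>] ip_sym[of Y "H X"]
      ip_sym[of X "H Y"] H_skew[of Y X]
    by (simp add: torsion_free ip_lin h_nabla)
  have "ext2 ?B X Y Z = ext2 (\<lambda>X Y. ip (H X) Y) X Y Z + ext2 (\<lambda>X Y. ip (H X) Y) X Y Z"
    using v unfolding ext2_def by (simp add: B)
  then show ?thesis
    using fun_cong[OF ext2_ext1[OF xi_VF v], of p]
    by (simp add: ext2_skew_tensor[OF h_tensor H_skew v])
qed

text \<open>Covariant derivative of \<phi> h + h \<phi> = 0, paired with \<open>Z\<close>.\<close>

lemma T_K:
  assumes v: "X \<in> VF" "Y \<in> VF" "Z \<in> VF"
  shows "T X (H Y) Z p - T X Y (H Z) p - K X Y (P Z) p + K X (P Y) Z p = 0"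
proof -
  have 0: "cov_deriv D X \<phi> (H Y) + P (cov_deriv D X h Y) + cov_deriv D X h (P Y) + H (cov_deriv D X \<phi> Y) = 0"
    using v by (simp add: cov_deriv_def P_lin H_lin P_H D_minus_right)
  have "ip (P (cov_deriv D X h Y)) Z = - K X Y (P Z)"
    using phi_skew[of "cov_deriv D X h Y" Z] ip_sym[of "P Z"] v by simp
  moreover have "ip (H (cov_deriv D X \<phi> Y)) Z = - T X Y (H Z)"
    using H_skew[of "cov_deriv D X \<phi> Y" Z] ip_sym[of "H Z"] v by simp
  moreover have "ip (cov_deriv D X \<phi> (H Y) + P (cov_deriv D X h Y) + cov_deriv D X h (P Y) + H (cov_deriv D X \<phi> Y)) Z p = 0"
    unfolding 0 using v by (simp add: ip_lin)
  ultimately show ?thesis using v by (simp add: ip_lin)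
qed

text \<open>Total skewness makes the three terms of \<open>ext2_skew_tensor\<close> for \<phi>
  equal, so \<open>ext3_ext2\<close> applies to three times T.\<close>

lemma dT:
  assumes v: "W \<in> VF" "X \<in> VF" "Y \<in> VF" "Z \<in> VF"
  shows "vderiv W (T X Y Z) p - vderiv X (T W Y Z) p + vderiv Y (T W X Z) p - vderiv Z (T W X Y) p
    - T (br W X) Y Z p + T (br W Y) X Z p - T (br W Z) X Y p
    - T (br X Y) W Z p + T (br X Z) W Y p - T (br Y Z) W X p = 0"
proof -
  let ?F = "\<lambda>X Y. ip (P X) Y"
  have e: "ext2 ?F X Y Z = T X Y Z + T X Y Z + T X Y Z" if "X \<in> VF" "Y \<in> VF" "Z \<in> VF" for X Y Z
    using ext2_skew_tensor[OF phi_tensor phi_skew that] T_cyc[OF that] T_cyc[of Y Z X] that by simp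
  have add: "?F (X + Y) Z = ?F X Z + ?F Y Z" if "X \<in> VF" "Y \<in> VF" "Z \<in> VF" for X Y Z
    using that by (simp add: P_lin ip_lin)
  have "ip (P X) Y \<in> SF" if "X \<in> VF" "Y \<in> VF" for X Y using that by simp
  from fun_cong[OF ext3_ext2[of ?F, OF this phi_skew add v], of p]
  show ?thesis using v by (simp add: e)
qed

text \<open>\<open>sig\<close> is the covariant derivative of \<open>T\<close> in the direction \<open>\<xi>\<close>.\<close>

definition sig :: "'a vfield \<Rightarrow> 'a vfield \<Rightarrow> 'a vfield \<Rightarrow> 'a \<Rightarrow> real" where
  "sig X Y Z p = vderiv \<xi> (T X Y Z) p - T (D \<xi> X) Y Z p - T X (D \<xi> Y) Z p - T X Y (D \<xi> Z) p"

text \<open>With \<xi> in the first slot T is the 2-form g(\<phi> h Y, Z), whose derivative involves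
  only T and \<open>K\<close>.\<close>

lemma vderiv_T_xi:
  assumes v: "X \<in> VF" "Y \<in> VF" "Z \<in> VF"
  shows "vderiv X (T \<xi> Y Z) p = T X (H Y) Z p - K X Y (P Z) p + T \<xi> (D X Y) Z p + T \<xi> Y (D X Z) p"
proof -
  have 1: "D X (P (H Y)) = cov_deriv D X \<phi> (H Y) + (P (cov_deriv D X h Y) + P (H (D X Y)))"
    using v by (simp add: cov_deriv_def P_lin)
  have "ip (P (cov_deriv D X h Y)) Z = - K X Y (P Z)"
    using phi_skew[of "cov_deriv D X h Y" Z] ip_sym[of "P Z"] v by simp
  then show ?thesis
    using v metric_compatible[of X "P (H Y)" Z] by (simp add: cov_xi_phi 1 ip_lin)
qed

text \<open>This is dT(\<xi>, X, Y, Z) = 0 solved for the derivative along \<xi>. The terms T X (H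
  Y) Z from \<open>vderiv_T_xi\<close> cancel cyclically against those that D X \<xi> = H X
  contributes through the brackets.\<close>

lemma sig_K:
  assumes v: "X \<in> VF" "Y \<in> VF" "Z \<in> VF"
  shows "sig X Y Z p = - (K X Y (P Z) p + K Y Z (P X) p + K Z X (P Y) p)"
proof -
  have t12: "T U V W p = - T V U W p" if "U \<in> VF" "V \<in> VF" "W \<in> VF" for U V W
    using T_skew12[OF that] by simp
  have tc: "T U V W p = T V W U p" if "U \<in> VF" "V \<in> VF" "W \<in> VF" for U V W
    using T_cyc[OF that] by simp
  have br: "T (br U V) V' W p = T (D U V) V' W p - T (D V U) V' W p"
    if "U \<in> VF" "V \<in> VF" "V' \<in> VF" "W \<in> VF" for U V V' W
    using that by (simp add: torsion_free cov_deriv_lin_left[OF phi_tensor] ip_lin)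
  have "vderiv Y (T \<xi> X Z) p = - vderiv Y (T \<xi> Z X) p"
    unfolding T_skew23[OF xi_VF v(1,3)] using v by simp
  moreover have "T (D \<xi> Y) X Z p = - T X (D \<xi> Y) Z p" "T (H Y) X Z p = - T X (H Y) Z p"
    "T (D X Y) \<xi> Z p = - T \<xi> (D X Y) Z p" "T (D Z X) \<xi> Y p = - T \<xi> (D Z X) Y p"
    "T (D Y Z) \<xi> X p = - T \<xi> (D Y Z) X p"
    by (rule t12; simp add: v)+
  moreover have "T (D \<xi> Z) X Y p = T X Y (D \<xi> Z) p" "T Z (H X) Y p = T (H X) Y Z p"
    "T Y (H Z) X p = T (H Z) X Y p" "T (D Y X) \<xi> Z p = T \<xi> Z (D Y X) p"
    "T (D X Z) \<xi> Y p = T \<xi> Y (D X Z) p" "T (D Z Y) \<xi> X p = T \<xi> X (D Z Y) p"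
    by (rule tc; simp add: v)+
  moreover note br[OF xi_VF v(1,2,3)] br[OF xi_VF v(2,1,3)] br[OF xi_VF v(3,1,2)]
    br[OF v(1,2) xi_VF v(3)] br[OF v(1,3) xi_VF v(2)] br[OF v(2,3) xi_VF v(1)]
  moreover note vderiv_T_xi[OF v, of p] vderiv_T_xi[OF v(2,3,1), of p] vderiv_T_xi[OF v(3,1,2), of p]
  moreover have "D X \<xi> = H X" "D Y \<xi> = H Y" "D Z \<xi> = H Z" using v by (simp_all add: h_nabla)
  ultimately show ?thesis
    using dT[OF xi_VF v, of p] unfolding sig_def by simp
qed

section \<open>T on fields orthogonal to \<xi>\<close>

definition horizontal :: "'a vfield \<Rightarrow> bool" where
  "horizontal X \<longleftrightarrow> X \<in> VF \<and> ip X \<xi> = 0"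

lemma horizontal_VF: "horizontal X \<Longrightarrow> X \<in> VF"
  and horizontal_xi: "horizontal X \<Longrightarrow> ip X \<xi> = 0"
  by (simp_all add: horizontal_def)

lemma horizontal_intros [intro, simp]:
  "X \<in> VF \<Longrightarrow> horizontal (P X)" "X \<in> VF \<Longrightarrow> horizontal (H X)"
  by (simp_all add: horizontal_def)

lemma horizontal_D_xi: assumes "horizontal Y" shows "horizontal (D \<xi> Y)"
proof -
  have Y: "Y \<in> VF" "ip Y \<xi> = 0" using assms by (simp_all add: horizontal_def)
  have "D \<xi> \<xi> = 0" using h_nabla[OF xi_VF] H_xi by simp
  then have "ip (D \<xi> Y) \<xi> = 0" using metric_compatible[of \<xi> Y \<xi>] Y by (simp add: ip_lin)
  then show ?thesis using Y by (simp add: horizontal_def)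
qed

text \<open>The error terms of \<open>T_phi_phi\<close> contain \<xi>-components. With total
  skewness, \<phi> thus moves between any two slots: on ker \<eta>, T has only the types (3,0) and
  (0,3).\<close>

lemma T_P_shift:
  assumes "X \<in> VF" "horizontal Y" "horizontal Z"
  shows "T X (P Y) Z = T X Y (P Z)"
proof -
  have "T X (P Y) Z - T X Y (P Z) = 0"
    using T_phi_phi[of X Y Z] assms by (simp add: horizontal_def)
  then show ?thesis by simp
qed

text \<open>\<open>T_P_shift\<close> differentiated along \<xi>; the right-hand side arises because
  \<phi> is not parallel along \<xi>, its derivative there being \<phi> h.\<close>

lemma sig_P_shift:
  assumes X: "X \<in> VF" and h: "horizontal Y" "horizontal Z"
  shows "sig X (P Y) Z p - sig X Y (P Z) p = - T X (P (H Y)) Z p + T X Y (P (H Z)) p"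
proof -
  note v = horizontal_VF[OF h(1)] horizontal_VF[OF h(2)]
  have DP: "D \<xi> (P U) = P (D \<xi> U) + P (H U)" if "U \<in> VF" for U
    using cov_xi_phi[OF that] by (simp add: cov_deriv_def algebra_simps)
  have "T X (P Y) Z = T X Y (P Z)" "T (D \<xi> X) (P Y) Z = T (D \<xi> X) Y (P Z)"
    "T X (P (D \<xi> Y)) Z = T X (D \<xi> Y) (P Z)" "T X (P Y) (D \<xi> Z) = T X Y (P (D \<xi> Z))"
    by (rule T_P_shift; simp add: X h v horizontal_D_xi)+
  then show ?thesis
    using X v by (simp add: sig_def DP cov_deriv_lin_right[OF phi_tensor] ip_lin)
qed

lemma P_P_horizontal: "horizontal X \<Longrightarrow> P (P X) = - X"
  by (simp add: P_P horizontal_def)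

lemma T_P_left:
  assumes h: "horizontal X" "horizontal Y" "horizontal Z"
  shows "T (P X) Y Z = T X Y (P Z)"
proof -
  note v = h[THEN horizontal_VF]
  have "T (P X) Y Z = - T Y (P X) Z" using v by (simp add: T_skew12[of "P X"])
  also have "\<dots> = - T Y X (P Z)" using T_P_shift[OF v(2) h(1,3)] by simp
  also have "\<dots> = T X Y (P Z)" using v by (simp add: T_skew12[of X])
  finally show ?thesis .
qed

text \<open>In terms of types with respect to \<open>\<phi>\<close>, \<open>sig_K\<close> together with \<open>T_K\<close> and \<open>K_cyc\<close> gives
  \<open>sig(X, Y, Z) = T(X, Y, h Z)\<close> for \<open>X, Y\<close> of type (1,0) and \<open>Z\<close> of type (0,1), whereas \<open>sig_P_shift\<close> gives
  half of that. The proof below is the real form of this comparison: the listed instances are those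
  entering one linear combination that equals \<open>T(X, Y, h Z)\<close>.\<close>

lemma T_H_horizontal:
  assumes h: "horizontal X" "horizontal Y" "horizontal Z"
  shows "T X Y (H Z) p = 0"
proof -
  note v [simp] = h[THEN horizontal_VF]
  note PP = h[THEN P_P_horizontal]
  have HP: "H (P U) = - P (H U)" if "U \<in> VF" for U using P_H[OF that] by simp
  have k23: "K U V W p = - K U W V p" if "U \<in> VF" "V \<in> VF" "W \<in> VF" for U V W
    using fun_cong[OF K_skew23[OF that], of p] by simp
  note lin = cov_deriv_lin_left(3)[OF phi_tensor] cov_deriv_lin_right(1)[OF phi_tensor]
    cov_deriv_lin_left(3)[OF h_tensor] cov_deriv_lin_right(1)[OF h_tensor] ip_lin(5,6) P_lin(3)
  note shift = T_P_left T_P_shift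
  \<comment> \<open>Normal form: \<phi> is moved to the left of h, its square on horizontal fields
    is -1, and each \<phi> inside T goes to the last slot.\<close>
  note norm = PP HP lin shift h P_P_horizontal
  have c: "K (P X) (P Y) (P Z) p + K (P Y) (P Z) (P X) p + K (P Z) (P X) (P Y) p = 0"
    "K Z X (P Y) p + K X (P Y) Z p + K (P Y) Z X p = 0"
    "K Y X (P Z) p + K X (P Z) Y p + K (P Z) Y X p = 0"
    "K Z (P X) Y p + K (P X) Y Z p + K Y Z (P X) p = 0"
    by (rule K_cyc; simp)+
  have t: "T X (H (P Y)) (P Z) p - T X (P Y) (H (P Z)) p - K X (P Y) (P (P Z)) p + K X (P (P Y)) (P Z) p = 0"
    "T (P X) (H (P Z)) Y p - T (P X) (P Z) (H Y) p - K (P X) (P Z) (P Y) p + K (P X) (P (P Z)) Y p = 0"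
    by (rule T_K; simp)+
  have f: "sig (P Y) (P Z) X p - sig (P Y) Z (P X) p = - T (P Y) (P (H Z)) X p + T (P Y) Z (P (H X)) p"
    "sig Y (P (P Z)) X p - sig Y (P Z) (P X) p = - T Y (P (H (P Z))) X p + T Y (P Z) (P (H X)) p"
    by (rule sig_P_shift; simp add: h)+
  have s: "sig (P Y) (P Z) X p = - (K (P Y) (P Z) (P X) p + K (P Z) X (P (P Y)) p + K X (P Y) (P (P Z)) p)"
    "sig (P Y) Z (P X) p = - (K (P Y) Z (P (P X)) p + K Z (P X) (P (P Y)) p + K (P X) (P Y) (P Z) p)"
    "sig Y (P (P Z)) X p = - (K Y (P (P Z)) (P X) p + K (P (P Z)) X (P Y) p + K X Y (P (P (P Z))) p)"
    "sig Y (P Z) (P X) p = - (K Y (P Z) (P (P X)) p + K (P Z) (P X) (P Y) p + K (P X) Y (P (P Z)) p)"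
    by (rule sig_K; simp)+
  have k: "K (P Y) (P Z) (P X) p = - K (P Y) (P X) (P Z) p" "K (P X) (P Z) (P Y) p = - K (P X) (P Y) (P Z) p"
    "K X (P Z) Y p = - K X Y (P Z) p" "K (P X) Z Y p = - K (P X) Y Z p" "K (P Z) Y X p = - K (P Z) X Y p"
    "K Y (P Z) X p = - K Y X (P Z) p"
    by (rule k23; simp)+
  have y: "T Y (H Z) X = T X Y (H Z)" "T Y Z (H X) = T (H X) Y Z"
    by (rule T_cyc[symmetric] T_cyc; simp)+
  have y2: "T X (H Z) Y = - T X Y (H Z)" "T X Z (H Y) = - T X (H Y) Z"
    by (rule T_skew23; simp)+
  show ?thesis
    using c t f s k y y2
    by (simp add: norm)
qed

text \<open>Only the value of \<open>Z\<close> at \<open>p\<close> matters in the last slot, and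
  \<open>onto\<close> writes it as a value of h. Removing the \<xi>-component of the extended
  preimage makes it horizontal and is invisible to h.\<close>

lemma T_horizontal:
  assumes onto: "\<And>w. w \<in> TS p \<Longrightarrow> \<eta> p w = 0 \<Longrightarrow> \<exists>v\<in>TS p. \<eta> p v = 0 \<and> h p v = w"
    and h: "horizontal X" "horizontal Y" "horizontal Z"
  shows "T X Y Z p = 0"
proof -
  have Z: "Z \<in> VF" "ip Z \<xi> = 0" using h(3) by (simp_all add: horizontal_def)
  from fun_cong[OF Z(2), of p] have "g p (Z p) (\<xi> p) = 0" by (simp only: tapply2_apply zero_fun_apply)
  then have "\<eta> p (Z p) = 0" using Z(1) by (simp add: eta_g)
  then obtain v where v: "v \<in> TS p" "h p v = Z p" using onto[of "Z p"] Z by auto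
  obtain V where V: "V \<in> VF" "V p = v" using VF_ext v by blast
  let ?V = "V - fmult (ip V \<xi>) \<xi>"
  have "horizontal ?V" using V by (simp add: horizontal_def ip_lin ip_fmult ip_xi_xi)
  from T_H_horizontal[OF h(1,2) this, of p] have "T X Y (H ?V) p = 0" .
  moreover have "H ?V p = Z p"
    using V v by (simp add: H_lin H_xi tapply_apply)
  ultimately show ?thesis by (simp add: tapply2_apply)
qed

text \<open>By \<open>T_horizontal\<close>, \<open>T = \<eta> \<and> \<Psi>\<close>, so on horizontal fields only the bracket terms of \<open>dT\<close> survive, and
  \<open>\<eta>([X, Y]) = - 2 g(h X, Y)\<close>.\<close>

lemma wedge_fields:
  assumes onto: "\<And>w p. w \<in> TS p \<Longrightarrow> \<eta> p w = 0 \<Longrightarrow> \<exists>v\<in>TS p. \<eta> p v = 0 \<and> h p v = w"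
    and hor: "horizontal W" "horizontal X" "horizontal Y" "horizontal Z"
  shows "ip (H W) X p * ip (P (H Y)) Z p - ip (H W) Y p * ip (P (H X)) Z p + ip (H W) Z p * ip (P (H X)) Y p
    + ip (H X) Y p * ip (P (H W)) Z p - ip (H X) Z p * ip (P (H W)) Y p + ip (H Y) Z p * ip (P (H W)) X p = 0"
proof -
  note v [simp] = hor[THEN horizontal_VF]
  \<comment> \<open>Vanishing at every point is needed, since \<open>dT\<close> differentiates these
    functions.\<close>
  have T0: "T A B C = 0" if "horizontal A" "horizontal B" "horizontal C" for A B C
    by (rule ext) (use T_horizontal[OF onto that] in simp)
  have br: "T (br A B) C E p = - 2 * ip (H A) B p * ip (P (H C)) E p"
    if h: "horizontal A" "horizontal B" "horizontal C" "horizontal E" for A B C E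
  proof -
    note w [simp] = h[THEN horizontal_VF]
    \<comment> \<open>T vanishes on the horizontal part of the bracket, so only its \<xi>-component
      counts.\<close>
    let ?N = "br A B - fmult (ip (br A B) \<xi>) \<xi>"
    have N: "horizontal ?N" by (simp add: horizontal_def ip_lin ip_fmult ip_xi_xi)
    have "ip (br A B) \<xi> = - (ip (H A) B + ip (H A) B)"
    proof -
      have "ip (D A B) \<xi> = - ip B (H A)" "ip (D B A) \<xi> = - ip A (H B)"
        using metric_compatible[of A B \<xi>] metric_compatible[of B A \<xi>] horizontal_xi[OF h(1)] horizontal_xi[OF h(2)]
        by (simp_all add: h_nabla eq_neg_iff_add_eq_0)
      then show ?thesis
        using ip_sym[of B "H A"] ip_sym[of A "H B"] H_skew[of B A] by (simp add: torsion_free ip_lin)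
    qed
    moreover have "T (br A B) C E p = T ?N C E p + ip (br A B) \<xi> p * T \<xi> C E p"
      by (simp add: cov_deriv_lin_left[OF phi_tensor] ip_lin ip_fmult)
    ultimately show ?thesis
      using T0[OF N h(3,4)] by (simp add: cov_xi_phi)
  qed
  show ?thesis
    using dT[OF v, of p] hor by (simp add: T0 br)
qed

lemma wedge_at:
  assumes onto: "\<And>w p. w \<in> TS p \<Longrightarrow> \<eta> p w = 0 \<Longrightarrow> \<exists>v\<in>TS p. \<eta> p v = 0 \<and> h p v = w"
    and t: "w \<in> TS p" "x \<in> TS p" "y \<in> TS p" "z \<in> TS p"
    and k: "g p w (\<xi> p) = 0" "g p x (\<xi> p) = 0" "g p y (\<xi> p) = 0" "g p z (\<xi> p) = 0"
  shows "g p (h p w) x * g p (\<phi> p (h p y)) z - g p (h p w) y * g p (\<phi> p (h p x)) z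
    + g p (h p w) z * g p (\<phi> p (h p x)) y + g p (h p x) y * g p (\<phi> p (h p w)) z
    - g p (h p x) z * g p (\<phi> p (h p w)) y + g p (h p y) z * g p (\<phi> p (h p w)) x = 0"
proof -
  have ext: "\<exists>V. horizontal V \<and> V p = u" if u: "u \<in> TS p" "g p u (\<xi> p) = 0" for u
  proof -
    obtain V where V: "V \<in> VF" "V p = u" using VF_ext u by blast
    have "horizontal (V - fmult (ip V \<xi>) \<xi>)"
      using V by (simp add: horizontal_def ip_lin ip_fmult ip_xi_xi)
    moreover have "(V - fmult (ip V \<xi>) \<xi>) p = u" using u V by (simp add: fmult_apply tapply2_apply)
    ultimately show ?thesis by blast
  qed
  obtain W X Y Z where "horizontal W" "horizontal X" "horizontal Y" "horizontal Z"
    "W p = w" "X p = x" "Y p = y" "Z p = z"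
    using ext[OF t(1) k(1)] ext[OF t(2) k(2)] ext[OF t(3) k(3)] ext[OF t(4) k(4)] by blast
  then show ?thesis
    using wedge_fields[OF onto, of W X Y Z p] by (simp add: tapply2_apply tapply_apply)
qed

end

section \<open>Bases of a tangent space\<close>

context riemannian_manifold
begin

lemma orthogonal_independent:
  assumes B: "finite B" "B \<subseteq> TS p" "0 \<notin> B" and orth: "\<And>u v. u \<in> B \<Longrightarrow> v \<in> B \<Longrightarrow> u \<noteq> v \<Longrightarrow> g p u v = 0"
  shows "independent B"
proof
  assume "dependent B"
  then obtain f x where s: "(\<Sum>u\<in>B. f u *\<^sub>R u) = 0" and x: "x \<in> B" "f x \<noteq> 0"
    unfolding dependent_finite[OF B(1)] by blast
  \<comment> \<open>Membership of the partial sums in \<open>TS p\<close> is carried along because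
    \<open>g p\<close> is linear only there.\<close>
  have "(\<Sum>u\<in>C. f u *\<^sub>R u) \<in> TS p \<and> g p x (\<Sum>u\<in>C. f u *\<^sub>R u) = (\<Sum>u\<in>C. f u * g p x u)" if "finite C" "C \<subseteq> B" for C
    using that
  proof (induction C)
    case empty
    have "x \<in> TS p" using x B by auto
    then show ?case by (simp only: sum.empty TS_simps g_zero)
  next
    case (insert c C)
    then have "c \<in> TS p" "x \<in> TS p" "(\<Sum>u\<in>C. f u *\<^sub>R u) \<in> TS p"
      "g p x (\<Sum>u\<in>C. f u *\<^sub>R u) = (\<Sum>u\<in>C. f u * g p x u)" using B x by auto
    then show ?case
      by (simp only: sum.insert[OF insert.hyps] TS_simps g_add g_scale)
  qed
  from this[OF B(1) subset_refl] have "g p x 0 = (\<Sum>u\<in>B. f u * g p x u)" unfolding s by (rule conjunct2)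
  moreover have xT: "x \<in> TS p" using x B(2) by blast
  ultimately have "(\<Sum>u\<in>B. f u * g p x u) = 0" by (simp only: g_zero)
  moreover have "(\<Sum>u\<in>B. f u * g p x u) = (\<Sum>u\<in>B. if u = x then f x * g p x x else 0)"
    by (rule sum.cong) (use orth x in auto)
  moreover have "\<dots> = f x * g p x x" using B(1) x by (simp add: sum.delta)
  ultimately have "f x * g p x x = 0" by (simp only:)
  moreover have "x \<noteq> 0" using x B(3) by metis
  then have "g p x x > 0" by (rule g_pos[OF xT])
  then have "g p x x \<noteq> 0" by (rule less_imp_neq[symmetric])
  ultimately show False using x(2) by (simp only: mult_eq_0_iff simp_thms)
qed

text \<open>Exchange in both directions with the image of the standard basis under the coordinates
  \<open>L\<close>.\<close>

lemma card_basis_TS: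
  assumes "independent B" "finite B" "B \<subseteq> TS p" "TS p \<subseteq> span B"
  shows "card B = DIM('e)"
proof -
  obtain L :: "'e \<Rightarrow> 'a tvec" where L: "linear L" "inj L" "range L = TS p"
    using tangent_space_coords[OF atlas] by blast
  have ind: "independent (L ` Basis)"
    using linear_independent_injective_image[OF L(1) independent_Basis] inj_on_subset[OF L(2) subset_UNIV] .
  have sp: "span (L ` Basis) = TS p"
    using linear_span_image[OF L(1), of Basis] L(3) by simp
  have c: "card (L ` Basis) = DIM('e)" by (rule card_image[OF inj_on_subset[OF L(2) subset_UNIV]])
  have "card B \<le> card (L ` Basis)"
    using independent_span_bound[of "L ` Basis" B] assms sp by simp
  moreover have "L ` Basis \<subseteq> span B"
    using span_superset[of "L ` Basis"] assms(4) unfolding sp by (rule subset_trans)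
  then have "card (L ` Basis) \<le> card B"
    using independent_span_bound[of B "L ` Basis"] assms ind by simp
  ultimately show ?thesis using c by simp
qed

end

section \<open>The dimension count at one point\<close>

context nearly_cosymplectic_manifold
begin

lemma h_skew_at:
  assumes "u \<in> TS p" "v \<in> TS p" shows "g p (h p u) v = - g p (h p v) u"
proof -
  obtain X Y where XY: "X \<in> VF" "Y \<in> VF" "X p = u" "Y p = v" using VF_ext assms by meson
  from fun_cong[OF H_skew[OF XY(1,2)], of p] show ?thesis
    using XY by (simp add: tapply2_apply tapply_apply)
qed

lemma phi_h:
  assumes "u \<in> TS p" shows "\<phi> p (h p u) = - h p (\<phi> p u)"
proof -
  obtain X where X: "X \<in> VF" "X p = u" using VF_ext assms by blast
  from fun_cong[OF P_H[OF X(1)], of p] show ?thesis using X by (simp add: tapply_apply)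
qed

text \<open>For nonzero \<open>x \<in> ker \<eta>\<close> put \<open>a = h x\<close> and \<open>c = \<phi> h x\<close>. Evaluating the wedge identity on
  \<open>x, a, z, w\<close> with \<open>w\<close> orthogonal to \<open>a\<close> and \<open>c\<close> shows that \<open>\<phi> h w\<close> lies in the span of \<open>a\<close> and \<open>c\<close>,
  that is, \<open>w\<close> lies in the span of \<open>\<phi> x\<close> and \<open>x\<close>.\<close>

lemma dimension_five:
  assumes onto: "\<And>w p. w \<in> TS p \<Longrightarrow> \<eta> p w = 0 \<Longrightarrow> \<exists>v\<in>TS p. \<eta> p v = 0 \<and> h p v = w"
    and dim: "DIM('e) > 1"
  shows "DIM('e) = 5"
proof -
  \<comment> \<open>The manifold is a whole type, hence nonempty, and one point is enough.\<close>
  obtain p :: 'a where True by blast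
  let ?x0 = "\<xi> p"
  have xi1: "g p ?x0 ?x0 = 1" using eta_xi[of p] by (simp add: eta_g)
  have "?x0 \<noteq> 0" using xi1 by (auto simp: g_zero)
  obtain v where v: "v \<in> TS p" "v \<notin> span {?x0}"
  proof (rule ccontr)
    assume "\<not> thesis"
    then have "TS p \<subseteq> span {?x0}" using that by blast
    then have "card {?x0} = DIM('e)"
      using \<open>?x0 \<noteq> 0\<close> by (intro card_basis_TS[of _ p]) auto
    then show False using dim by simp
  qed
  define x where "x = v - g p v ?x0 *\<^sub>R ?x0"
  have x: "x \<in> TS p" "g p x ?x0 = 0" using v xi1 by (simp_all add: x_def g_lin)
  have "x \<noteq> 0"
  proof
    assume "x = 0"
    then have "v = g p v ?x0 *\<^sub>R ?x0" by (simp add: x_def)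
    then show False using v(2) span_scale[OF span_base[of ?x0 "{?x0}"]] by (metis insertI1)
  qed
  \<comment> \<open>The kernel of a skew map is orthogonal to its image, and here \<open>u\<close>
    lies in both.\<close>
  have h_inj: "u = 0" if u: "u \<in> TS p" "g p u ?x0 = 0" "h p u = 0" for u
  proof -
    obtain w where w: "w \<in> TS p" "h p w = u" using onto[of u p] u by (auto simp: eta_g)
    have "g p u u = 0" using h_skew_at[of u p w] u w by (simp add: g_zero)
    then show ?thesis using g_pos[of u p] u by auto
  qed
  have pp: "\<phi> p (\<phi> p u) = - u" if "u \<in> TS p" "g p u ?x0 = 0" for u
    using phi_phi[of u p] that by (simp add: Q_identity eta_g)
  define a where "a = h p x"
  define b where "b = \<phi> p x"
  define c where "c = \<phi> p (h p x)"
  have t [simp]: "?x0 \<in> TS p" "x \<in> TS p" "a \<in> TS p" "b \<in> TS p" "c \<in> TS p" using x by (simp_all add: a_def b_def c_def)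
  have k: "g p a ?x0 = 0" "g p b ?x0 = 0" "g p c ?x0 = 0"
    using x by (simp_all add: a_def b_def c_def g_h_xi g_phi_xi)
  have hskew0: "g p (h p u) u = 0" if "u \<in> TS p" for u using h_skew_at[OF that that] by simp
  have pskew0: "g p (\<phi> p u) u = 0" if "u \<in> TS p" for u using phi_skew_at[OF that that] by simp
  have hb: "h p b = - c" using phi_h[OF x(1)] by (simp add: b_def c_def)
  have pc: "\<phi> p c = - a" using pp[of a] k by (simp add: a_def c_def)
  \<comment> \<open>For g(c, x) and g(b, a), skewness of \<phi> makes them opposite, while skewness
    of h together with \<open>hb\<close> makes them equal; so both vanish.\<close>
  have o: "g p a x = 0" "g p b x = 0" "g p c x = 0" "g p b a = 0" "g p c a = 0" "g p c b = 0"
  proof -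
    show "g p a x = 0" "g p b x = 0" "g p c a = 0" using hskew0 pskew0 x by (simp_all add: a_def b_def c_def)
    have 1: "g p c x = - g p b a" using phi_skew_at[of "h p x" p x] x by (simp add: a_def b_def c_def)
    have 2: "g p (h p b) x = - g p a b" using h_skew_at[of b p x] by (simp add: a_def)
    then have "g p c x = g p b a" using hb g_sym[of a p b] by (simp add: g_minus)
    with 1 show "g p c x = 0" "g p b a = 0" by simp_all
    show "g p c b = 0" using hskew0[of b] hb by (simp add: g_minus)
  qed
  have nz: "a \<noteq> 0" "b \<noteq> 0" "c \<noteq> 0"
  proof -
    show a0: "a \<noteq> 0"
    proof
      assume "a = 0"
      from h_inj[OF x this[unfolded a_def]] \<open>x \<noteq> 0\<close> show False by contradiction
    qed
    have *: "u \<noteq> 0" if "\<phi> p u = - y" "y \<noteq> 0" for u y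
    proof
      assume "u = 0"
      with that(1) have "- y = 0" by (simp only: zero_at)
      then have "y = 0" by (simp only: neg_equal_0_iff_equal)
      with that(2) show False by contradiction
    qed
    show "c \<noteq> 0" by (rule *[OF pc a0])
    show "b \<noteq> 0" by (rule *[OF pp[OF x, folded b_def] \<open>x \<noteq> 0\<close>])
  qed
  let ?B = "{?x0, x, a, b, c}"
  have orth: "g p u v = 0" if "u \<in> ?B" "v \<in> ?B" "u \<noteq> v" for u v
    using that o k x g_sym[of x p ?x0] g_sym[of a p ?x0] g_sym[of b p ?x0] g_sym[of c p ?x0]
      g_sym[of a p x] g_sym[of b p x] g_sym[of c p x] g_sym[of b p a] g_sym[of c p a] g_sym[of c p b]
    by auto
  have ind: "independent ?B"
    by (rule orthogonal_independent[of _ p]) (use orth nz \<open>x \<noteq> 0\<close> \<open>?x0 \<noteq> 0\<close> in auto)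
  have ga: "g p a a > 0" "g p c c > 0" using g_pos nz by simp_all
  have span: "u \<in> span ?B" if u: "u \<in> TS p" for u
  proof -
    \<comment> \<open>The components along \<open>x\<close> and \<open>b\<close> stay in, as
      \<open>w\<close> is to be shown a combination of these two. Orthogonality to \<open>a\<close>
      and \<open>c\<close> removes the wedge terms in which h x or \<phi> h x is paired with
      \<open>w\<close>.\<close>
    define w where "w = u - g p u ?x0 *\<^sub>R ?x0 - (g p u a / g p a a) *\<^sub>R a - (g p u c / g p c c) *\<^sub>R c"
    have w: "w \<in> TS p" "g p w ?x0 = 0" "g p w a = 0" "g p w c = 0"
      using u k xi1 ga o g_sym[of a p ?x0] g_sym[of c p ?x0] g_sym[of c p a]
      by (simp_all add: w_def g_lin)
    define \<kappa> where "\<kappa> = g p (\<phi> p (h p a)) w"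
    define l where "l = g p (h p a) w"
    \<comment> \<open>Chosen so that \<phi> h maps it to \<open>?s\<close>: \<phi> h sends
      \<open>b\<close> to \<open>a\<close> and \<open>x\<close> to \<open>c\<close>. The
      coefficients \<kappa> and \<open>l\<close> are those left in the wedge identity on
      \<open>x\<close>, \<open>a\<close>, \<open>z\<close>, \<open>w\<close>.\<close>
    let ?q = "g p a a *\<^sub>R w + \<kappa> *\<^sub>R b + l *\<^sub>R x"
    let ?s = "g p a a *\<^sub>R \<phi> p (h p w) + \<kappa> *\<^sub>R a + l *\<^sub>R c"
    have q: "?q \<in> TS p" "g p ?q ?x0 = 0" using w k x by (simp_all add: g_lin)
    have pa: "\<phi> p a = c" by (simp add: a_def c_def)
    have ps: "\<phi> p (h p ?q) = ?s"
      using w x hb pc pa by (simp add: h_at phi_at a_def[symmetric] c_def[symmetric])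
    have s: "?s \<in> TS p" "g p ?s ?x0 = 0" using w k by (simp_all add: g_lin g_phi_xi)
    \<comment> \<open>The wedge identity with \<open>z\<close> free says that \<open>?s\<close> is
      orthogonal to ker \<eta>. As \<open>?s\<close> lies in ker \<eta> it is 0, and injectivity of
      \<phi> h there gives \<open>?q = 0\<close>.\<close>
    have z: "g p ?s z = 0" if z: "z \<in> TS p" "g p z ?x0 = 0" for z
    proof -
      have "g p (\<phi> p (h p z)) w = - g p (\<phi> p (h p w)) z"
        using phi_skew_at[of "h p z" p w] h_skew_at[of z p "\<phi> p w"] phi_h[of w p] z w
          g_sym[of "h p z" p "\<phi> p w"] by (simp add: g_minus)
      moreover have "g p a w = 0" "g p c w = 0" using w g_sym[of w p a] g_sym[of w p c] by simp_all
      ultimately show ?thesis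
        using wedge_at[OF onto x(1) t(3) z(1) w(1) x(2) k(1) z(2) w(2)] z w o
        by (simp add: pa a_def[symmetric] \<kappa>_def[symmetric] l_def[symmetric] g_lin algebra_simps)
    qed
    have "g p ?s ?s = 0" using z[OF s] .
    then have "?s = 0" using g_pos[OF s(1)] by auto
    then have "\<phi> p (h p ?q) = 0" using ps by simp
    then have "h p ?q = 0" using pp[of "h p ?q"] q by (simp add: g_h_xi)
    then have "?q = 0" using h_inj[OF q] by simp
    then have "g p a a *\<^sub>R w = - \<kappa> *\<^sub>R b - l *\<^sub>R x" by (simp add: algebra_simps eq_neg_iff_add_eq_0)
    then have "(1 / g p a a) *\<^sub>R (g p a a *\<^sub>R w) = (1 / g p a a) *\<^sub>R (- \<kappa> *\<^sub>R b - l *\<^sub>R x)" by simp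
    then have "w = (1 / g p a a) *\<^sub>R (- \<kappa> *\<^sub>R b - l *\<^sub>R x)" using ga by simp
    moreover have "\<dots> \<in> span ?B"
      by (intro span_scale span_diff) (auto intro: span_base)
    ultimately have "w \<in> span ?B" by simp
    then have "w + (g p u ?x0 *\<^sub>R ?x0 + (g p u a / g p a a) *\<^sub>R a + (g p u c / g p c c) *\<^sub>R c) \<in> span ?B"
      by (intro span_add span_scale) (auto intro: span_base)
    then show ?thesis by (simp add: w_def)
  qed
  have "card ?B = DIM('e)"
    using ind span by (intro card_basis_TS[of _ p]) auto
  moreover have "card ?B = 5"
  proof -
    have "u \<noteq> v" if "g p u v = 0" "u \<noteq> 0" "u \<in> TS p" for u v
      using that g_pos[of u p] by auto
    then have "?x0 \<noteq> x" "?x0 \<noteq> a" "?x0 \<noteq> b" "?x0 \<noteq> c" "x \<noteq> a" "x \<noteq> b" "x \<noteq> c" "a \<noteq> b" "a \<noteq> c" "b \<noteq> c"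
      using o k x nz \<open>x \<noteq> 0\<close> t by metis+
    then show ?thesis by simp
  qed
  ultimately show ?thesis by simp
qed

end

theorem theorem4p2:
  fixes \<A> :: "('a::{t2_space, second_countable_topology}, 'e::euclidean_space) chart set"
    and \<phi> Q h :: "'a tensor11" and \<xi> :: "'a vfield" and \<eta> :: "'a one_form"
    and g :: "'a tensor02" and D :: "'a conn" and n :: nat
  assumes "smooth_atlas \<A>"
    and "n \<ge> 1" and "DIM('e) = 2 * n + 1"
    and "weak_nearly_cosymplectic \<A> \<phi> Q \<xi> \<eta> g D"
    and A: "\<forall>X\<in>vector_fields \<A>. \<forall>Y\<in>ker_fields \<A> \<eta>. cov_deriv D X Q Y = 0"
    and B: "\<forall>X\<in>ker_fields \<A> \<eta>. \<forall>Y\<in>ker_fields \<A> \<eta>. \<forall>Z\<in>ker_fields \<A> \<eta>.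
              curvature D (tapply (tilde Q) X) Y Z \<in> ker_fields \<A> \<eta>"
    and "is_tensor11 \<A> h"
    and "\<forall>X\<in>vector_fields \<A>. tapply h X = D X \<xi>"
    and "\<forall>p. simple_eigenvalue_on (tangent_space \<A> p) (\<lambda>v. h p (h p v)) 0"
  shows "DIM('e) = 5"
proof -
  interpret weak_nearly_cosymplectic_manifold \<A> \<phi> Q h \<xi> \<eta> g D
    using assms by unfold_locales simp_all
  interpret nearly_cosymplectic_manifold \<A> \<phi> Q h \<xi> \<eta> g D
    by unfold_locales (rule Q_id[OF A assms(9)])
  show ?thesis
    using dimension_five h_onto_ker_eta assms(2,3,9) by simp
qed

end
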